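(* Let $(X_i,Z_i)_{i\ge1}$ be i.i.d. with joint distribution $P_{XZ}$ on finite alphabets $\mathcal{X}\times\mathcal{Z}$, and let $D:\mathcal{X}\times\mathcal{X}\to[0,d_{\max}]$, $d_{\max}<\infty$, be a per-letter distortion measure. (i) If $(R,R_0,\Delta,\Pi)$ is achievable with respect to the empirical perceptual constraint, then $(R,R_0,\Delta,\Pi)\in\mathrm{cl}(\mathcal{R}^{(e)})$. (ii) If $(R,R_0,\Delta,\Pi)$ is achievable with respect to the strong perceptual constraint by codes for which the output $Y^n=g_n(f_n(X^n,Z^n,K),Z^n,K)$ and the side information $Z^n$ are jointly i.i.d. sequences, then $(R,R_0,\Delta,\Pi)\in\mathrm{cl}(\mathcal{R}^{(s)})$.
   Context: Notation: $[m]=\{1,\dots,\lfloor m\rfloor\}$; $\hat P_{x^n}(x)=\frac1n\sum_{i=1}^n\mathbf 1\{x_i=x\}$ is the empirical distribution; $d_{\mathrm{TV}}(P,Q)=\sup_A|P(A)-Q(A)|$; $D(x^n,y^n)=\frac1n\sum_{i=1}^nD(x_i,y_i)$; $\mathrm{cl}$ denotes closure. An $(n,2^{nR},2^{nR_0})$ code consists of a (possibly stochastic) encoder $f_n:\mathcal{X}^n\times\mathcal{Z}^n\times[2^{nR_0}]\to[2^{nR}]$ and a (possibly stochastic) decoder $g_n:[2^{nR}]\times\mathcal{Z}^n\times[2^{nR_0}]\to\mathcal{X}^n$, with common randomness $K$ uniform on $[2^{nR_0}]$ independent of $(X^n,Z^n)$, and output $Y^n=g_n(f_n(X^n,Z^n,K),Z^n,K)$.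 $(R,R_0,\Delta,\Pi)$ is achievable with respect to empirical (resp. strong) perception if for every $\epsilon>0$ there is a sequence of $(n,2^{n(R+\epsilon)},2^{n(R_0+\epsilon)})$ codes with $\mathbb{E}[D(X^n,Y^n)]\le\Delta+\epsilon$ and $\mathbb{E}[d_{\mathrm{TV}}(\hat P_{X^n},\hat P_{Y^n})]\le\Pi+\epsilon$ (resp. $d_{\mathrm{TV}}(P_{X^n},P_{Y^n})\le\Pi+\epsilon$). Regions (joint distributions have $(X,Z)\sim P_{XZ}$, $Y$ valued in $\mathcal{X}$, $U$ auxiliary, $P_X,P_Y$ marginals): $R(\Delta)=\inf_{P_{Y|XZ}:\,\mathbb{E}[D(X,Y)]\le\Delta}I(X;Y|Z)$; $g(R,\Delta)=\inf_{P_{Y|XZ}:\,I(X;Y|Z)\le R,\ \mathbb{E}[D(X,Y)]\le\Delta}\limsup_{n}d_{\mathrm{TV}}(\prod_{i=1}^nP_X,\prod_{i=1}^nP_Y)$; $f(\Delta)=g(R(\Delta),\Delta)$. For $\gamma>0$: $\mathcal{R}_\gamma^{(s)-}$: tuples with $\Pi<f(\Delta)$, $R_0>0$, such that some $(U,Y)$ has $X\perp Y\mid(U,Z)$, $R\ge I(X;U|Z)+\gamma$, $R+R_0\ge I(Y;U|Z)+\gamma$, $\Delta\ge\mathbb{E}[D(X,Y)]$, $\Pi\ge\limsup_n d_{\mathrm{TV}}(\prod_{i=1}^nP_X,\prod_{i=1}^nP_Y)$. $\mathcal{R}_\gamma^{(s)+}$: tuples with $\Pi\ge f(\Delta)$,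 $R_0\ge0$, such that some $Y$ has $R\ge I(X;Y|Z)+\gamma$, $\Delta\ge\mathbb{E}[D(X,Y)]$. $\mathcal{R}_\gamma^{(e)}$: tuples with $R_0\ge0$ such that some $Y$ has $R\ge I(X;Y|Z)+\gamma$, $\Delta\ge\mathbb{E}[D(X,Y)]$, $\Pi\ge d_{\mathrm{TV}}(P_X,P_Y)$. Finally $\mathcal{R}^{(e)}=\bigcup_{\gamma>0}\mathcal{R}_\gamma^{(e)}$ and $\mathcal{R}^{(s)}=\bigcup_{\gamma>0}(\mathcal{R}_\gamma^{(s)-}\cup\mathcal{R}_\gamma^{(s)+})$. *)

theory Defs
  imports "HOL-Probability.Probability"
begin

definition tv :: "'a pmf \<Rightarrow> 'a pmf \<Rightarrow> real" where
  "tv P Q = (SUP A. \<bar>measure_pmf.prob P A - measure_pmf.prob Q A\<bar>)"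

definition cmi :: "('a \<times> 'b \<times> 'c) pmf \<Rightarrow> real" where
  "cmi J = (\<Sum>t\<in>set_pmf J. case t of (a, b, c) \<Rightarrow>
      pmf J (a, b, c) * log 2 (pmf J (a, b, c) * pmf (map_pmf (\<lambda>(a, b, c). c) J) c
        / (pmf (map_pmf (\<lambda>(a, b, c). (a, c)) J) (a, c) * pmf (map_pmf (\<lambda>(a, b, c). (b, c)) J) (b, c))))"

definition cond_indep :: "('a \<times> 'b \<times> 'c) pmf \<Rightarrow> bool" where
  "cond_indep J \<longleftrightarrow> (\<forall>a b c.
      pmf J (a, b, c) * pmf (map_pmf (\<lambda>(a, b, c). c) J) c
      = pmf (map_pmf (\<lambda>(a, b, c). (a, c)) J) (a, c) * pmf (map_pmf (\<lambda>(a, b, c). (b, c)) J) (b, c))"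

definition emp :: "'a list \<Rightarrow> 'a pmf" where
  "emp xs = map_pmf (\<lambda>i. xs ! i) (pmf_of_set {..<length xs})"

definition avg_dist :: "('x \<Rightarrow> 'x \<Rightarrow> real) \<Rightarrow> 'x list \<Rightarrow> 'x list \<Rightarrow> real" where
  "avg_dist D xs ys = (\<Sum>i<length xs. D (xs ! i) (ys ! i)) / real (length xs)"

definition idx :: "nat \<Rightarrow> real \<Rightarrow> nat set" where
  "idx n r = {1 .. nat \<lfloor>2 powr (real n * r)\<rfloor>}"

definition is_code ::
  "nat \<Rightarrow> real \<Rightarrow> real \<Rightarrow> ('x list \<Rightarrow> 'z list \<Rightarrow> nat \<Rightarrow> nat pmf)
     \<Rightarrow> (nat \<Rightarrow> 'z list \<Rightarrow> nat \<Rightarrow> 'x list pmf) \<Rightarrow> bool" where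
  "is_code n R R0 e d \<longleftrightarrow>
     idx n R0 \<noteq> {} \<and>
     (\<forall>xs zs k. length xs = n \<longrightarrow> length zs = n \<longrightarrow> k \<in> idx n R0 \<longrightarrow>
        set_pmf (e xs zs k) \<subseteq> idx n R) \<and>
     (\<forall>m zs k. m \<in> idx n R \<longrightarrow> length zs = n \<longrightarrow> k \<in> idx n R0 \<longrightarrow>
        set_pmf (d m zs k) \<subseteq> {ys. length ys = n})"

definition code_joint ::
  "('x \<times> 'z) pmf \<Rightarrow> nat \<Rightarrow> real \<Rightarrow> ('x list \<Rightarrow> 'z list \<Rightarrow> nat \<Rightarrow> nat pmf)
     \<Rightarrow> (nat \<Rightarrow> 'z list \<Rightarrow> nat \<Rightarrow> 'x list pmf) \<Rightarrow> ('x list \<times> 'z list \<times> 'x list) pmf" where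
  "code_joint P n R0 e d = do {
     xzs \<leftarrow> replicate_pmf n P;
     k \<leftarrow> pmf_of_set (idx n R0);
     m \<leftarrow> e (map fst xzs) (map snd xzs) k;
     ys \<leftarrow> d m (map snd xzs) k;
     return_pmf (map fst xzs, map snd xzs, ys) }"

definition exp_dist :: "('x \<Rightarrow> 'x \<Rightarrow> real) \<Rightarrow> ('x list \<times> 'z list \<times> 'x list) pmf \<Rightarrow> real" where
  "exp_dist D J = measure_pmf.expectation J (\<lambda>(xs, zs, ys). avg_dist D xs ys)"

definition achievable_emp ::
  "('x \<times> 'z) pmf \<Rightarrow> ('x \<Rightarrow> 'x \<Rightarrow> real) \<Rightarrow> real \<Rightarrow> real \<Rightarrow> real \<Rightarrow> real \<Rightarrow> bool" where
  "achievable_emp P D R R0 \<Delta> Pm \<longleftrightarrow>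
    (\<forall>\<epsilon>>0. \<exists>(e :: nat \<Rightarrow> 'x list \<Rightarrow> 'z list \<Rightarrow> nat \<Rightarrow> nat pmf)
               (d :: nat \<Rightarrow> nat \<Rightarrow> 'z list \<Rightarrow> nat \<Rightarrow> 'x list pmf).
      eventually (\<lambda>n. is_code n (R + \<epsilon>) (R0 + \<epsilon>) (e n) (d n) \<and>
         exp_dist D (code_joint P n (R0 + \<epsilon>) (e n) (d n)) \<le> \<Delta> + \<epsilon> \<and>
         measure_pmf.expectation (code_joint P n (R0 + \<epsilon>) (e n) (d n))
            (\<lambda>(xs, zs, ys). tv (emp xs) (emp ys)) \<le> Pm + \<epsilon>) sequentially)"

definition achievable_strong_iid ::
  "('x \<times> 'z) pmf \<Rightarrow> ('x \<Rightarrow> 'x \<Rightarrow> real) \<Rightarrow> real \<Rightarrow> real \<Rightarrow> real \<Rightarrow> real \<Rightarrow> bool" where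
  "achievable_strong_iid P D R R0 \<Delta> Pm \<longleftrightarrow>
    (\<forall>\<epsilon>>0. \<exists>(e :: nat \<Rightarrow> 'x list \<Rightarrow> 'z list \<Rightarrow> nat \<Rightarrow> nat pmf)
               (d :: nat \<Rightarrow> nat \<Rightarrow> 'z list \<Rightarrow> nat \<Rightarrow> 'x list pmf).
      eventually (\<lambda>n. is_code n (R + \<epsilon>) (R0 + \<epsilon>) (e n) (d n) \<and>
         exp_dist D (code_joint P n (R0 + \<epsilon>) (e n) (d n)) \<le> \<Delta> + \<epsilon> \<and>
         tv (map_pmf (\<lambda>(xs, zs, ys). xs) (code_joint P n (R0 + \<epsilon>) (e n) (d n)))
            (map_pmf (\<lambda>(xs, zs, ys). ys) (code_joint P n (R0 + \<epsilon>) (e n) (d n))) \<le> Pm + \<epsilon> \<and>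
         (\<exists>Q :: ('x \<times> 'z) pmf.
            map_pmf (\<lambda>(xs, zs, ys). zip ys zs) (code_joint P n (R0 + \<epsilon>) (e n) (d n))
            = replicate_pmf n Q)) sequentially)"

definition chan_joint :: "('x \<times> 'z) pmf \<Rightarrow> ('x \<Rightarrow> 'z \<Rightarrow> 'x pmf) \<Rightarrow> ('x \<times> 'z \<times> 'x) pmf" where
  "chan_joint P W = do { (x, z) \<leftarrow> P; y \<leftarrow> W x z; return_pmf (x, z, y) }"

definition I_XY_Z :: "('x \<times> 'z \<times> 'x) pmf \<Rightarrow> real" where
  "I_XY_Z J = cmi (map_pmf (\<lambda>(x, z, y). (x, y, z)) J)"

definition ED :: "('x \<Rightarrow> 'x \<Rightarrow> real) \<Rightarrow> ('x \<times> 'z \<times> 'x) pmf \<Rightarrow> real" where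
  "ED D J = measure_pmf.expectation J (\<lambda>(x, z, y). D x y)"

definition PX :: "('x \<times> 'z \<times> 'x) pmf \<Rightarrow> 'x pmf" where
  "PX J = map_pmf (\<lambda>(x, z, y). x) J"

definition PY :: "('x \<times> 'z \<times> 'x) pmf \<Rightarrow> 'x pmf" where
  "PY J = map_pmf (\<lambda>(x, z, y). y) J"

definition tv_lim :: "'x pmf \<Rightarrow> 'x pmf \<Rightarrow> ereal" where
  "tv_lim P Q = limsup (\<lambda>n. ereal (tv (replicate_pmf n P) (replicate_pmf n Q)))"

text \<open>R(\<Delta>), g(R,\<Delta>), f(\<Delta>) as infima in the extended reals (inf of the empty set = +\<infinity>).\<close>
definition Rfun :: "('x \<times> 'z) pmf \<Rightarrow> ('x \<Rightarrow> 'x \<Rightarrow> real) \<Rightarrow> real \<Rightarrow> ereal" where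
  "Rfun P D \<Delta> = (INF W \<in> {W. ED D (chan_joint P W) \<le> \<Delta>}. ereal (I_XY_Z (chan_joint P W)))"

definition gfun :: "('x \<times> 'z) pmf \<Rightarrow> ('x \<Rightarrow> 'x \<Rightarrow> real) \<Rightarrow> ereal \<Rightarrow> real \<Rightarrow> ereal" where
  "gfun P D R \<Delta> = (INF W \<in> {W. ereal (I_XY_Z (chan_joint P W)) \<le> R \<and> ED D (chan_joint P W) \<le> \<Delta>}.
                     tv_lim (PX (chan_joint P W)) (PY (chan_joint P W)))"

definition ffun :: "('x \<times> 'z) pmf \<Rightarrow> ('x \<Rightarrow> 'x \<Rightarrow> real) \<Rightarrow> real \<Rightarrow> ereal" where
  "ffun P D \<Delta> = gfun P D (Rfun P D \<Delta>) \<Delta>"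

definition region_e_gamma :: "('x \<times> 'z) pmf \<Rightarrow> ('x \<Rightarrow> 'x \<Rightarrow> real) \<Rightarrow> real
    \<Rightarrow> (real \<times> real \<times> real \<times> real) set" where
  "region_e_gamma P D \<gamma> = {(R, R0, \<Delta>, Pm). R0 \<ge> 0 \<and>
     (\<exists>W. R \<ge> I_XY_Z (chan_joint P W) + \<gamma> \<and> \<Delta> \<ge> ED D (chan_joint P W) \<and>
          Pm \<ge> tv (PX (chan_joint P W)) (PY (chan_joint P W)))}"

definition region_e :: "('x \<times> 'z) pmf \<Rightarrow> ('x \<Rightarrow> 'x \<Rightarrow> real) \<Rightarrow> (real \<times> real \<times> real \<times> real) set" where
  "region_e P D = (\<Union>\<gamma>\<in>{0<..}. region_e_gamma P D \<gamma>)"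

definition region_s_minus_gamma :: "('x \<times> 'z) pmf \<Rightarrow> ('x \<Rightarrow> 'x \<Rightarrow> real) \<Rightarrow> real
    \<Rightarrow> (real \<times> real \<times> real \<times> real) set" where
  "region_s_minus_gamma P D \<gamma> = {(R, R0, \<Delta>, Pm). ereal Pm < ffun P D \<Delta> \<and> R0 > 0 \<and>
     (\<exists>J :: ('x \<times> 'z \<times> nat \<times> 'x) pmf.
        finite (set_pmf J) \<and>
        map_pmf (\<lambda>(x, z, u, y). (x, z)) J = P \<and>
        cond_indep (map_pmf (\<lambda>(x, z, u, y). (x, y, (u, z))) J) \<and>
        R \<ge> cmi (map_pmf (\<lambda>(x, z, u, y). (x, u, z)) J) + \<gamma> \<and>
        R + R0 \<ge> cmi (map_pmf (\<lambda>(x, z, u, y). (y, u, z)) J) + \<gamma> \<and>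
        \<Delta> \<ge> measure_pmf.expectation J (\<lambda>(x, z, u, y). D x y) \<and>
        ereal Pm \<ge> tv_lim (map_pmf (\<lambda>(x, z, u, y). x) J) (map_pmf (\<lambda>(x, z, u, y). y) J))}"

definition region_s_plus_gamma :: "('x \<times> 'z) pmf \<Rightarrow> ('x \<Rightarrow> 'x \<Rightarrow> real) \<Rightarrow> real
    \<Rightarrow> (real \<times> real \<times> real \<times> real) set" where
  "region_s_plus_gamma P D \<gamma> = {(R, R0, \<Delta>, Pm). ereal Pm \<ge> ffun P D \<Delta> \<and> R0 \<ge> 0 \<and>
     (\<exists>W. R \<ge> I_XY_Z (chan_joint P W) + \<gamma> \<and> \<Delta> \<ge> ED D (chan_joint P W))}"

definition region_s :: "('x \<times> 'z) pmf \<Rightarrow> ('x \<Rightarrow> 'x \<Rightarrow> real) \<Rightarrow> (real \<times> real \<times> real \<times> real) set" where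
  "region_s P D = (\<Union>\<gamma>\<in>{0<..}. region_s_minus_gamma P D \<gamma> \<union> region_s_plus_gamma P D \<gamma>)"

end

theory Submission
  imports Defs
begin

text \<open>
  Let \<open>T\<close> be uniform on the time indices and put \<open>U = (M, K, Z\<^sup>n, T)\<close> for the message \<open>M\<close> and the common
  randomness \<open>K\<close> of a code of length \<open>n\<close>. Given \<open>U\<close>, the output letter \<open>Y\<^sub>T\<close> is independent of \<open>X\<^sub>T\<close>. As
  \<open>(X\<^sub>i, Z\<^sub>i)\<close> is i.i.d., \<open>n I(X\<^sub>T;U|Z\<^sub>T) \<le> log |M|\<close>; when \<open>(Y\<^sub>i, Z\<^sub>i)\<close> is i.i.d. as well, the same
  argument gives \<open>n I(Y\<^sub>T;U|Z\<^sub>T) \<le> log (|M| |K|)\<close>. Part (i) follows from \<open>I(X;Y|Z) \<le> I(X;U|Z)\<close> and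
  the convexity of the total variation distance.

  In part (ii) the law of \<open>Y\<^sub>T\<close> may depend on \<open>n\<close>. If \<open>\<Pi> < 1\<close>, then the n-fold products of the laws
  of \<open>X\<close> and \<open>Y\<^sub>T\<close> stay at total variation distance bounded away from 1, which forces the law of \<open>Y\<^sub>T\<close>
  to converge to that of \<open>X\<close>. A maximal coupling then turns \<open>Y\<^sub>T\<close> into a variable with exactly the law
  of \<open>X\<close>; this changes the distortion by little and, by data processing, does not increase
  \<open>I(Y;U|Z)\<close>. If \<open>\<Pi> \<ge> 1\<close>, the perception constraint is void.
\<close>

section \<open>Conditional mutual information\<close>

lemma expectation_finite:
  fixes f :: "'a \<Rightarrow> real"
  assumes "finite (set_pmf M)"
  shows "measure_pmf.expectation M f = (\<Sum>a\<in>set_pmf M. pmf M a * f a)"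
  by (subst integral_measure_pmf[OF assms]) auto

lemma expectation_cong_pmf:
  fixes f g :: "'a \<Rightarrow> real"
  assumes "\<And>t. t \<in> set_pmf M \<Longrightarrow> f t = g t"
  shows "measure_pmf.expectation M f = measure_pmf.expectation M g"
  using assms by (intro integral_cong_AE) (auto simp: AE_measure_pmf_iff)

lemma expectation_mono_pmf:
  fixes f g :: "'a \<Rightarrow> real"
  assumes "finite (set_pmf M)" "\<And>t. t \<in> set_pmf M \<Longrightarrow> f t \<le> g t"
  shows "measure_pmf.expectation M f \<le> measure_pmf.expectation M g"
  unfolding expectation_finite[OF assms(1)] by (intro sum_mono mult_left_mono assms(2)) auto

text \<open>Jensen's inequality for the logarithm, obtained from the tangent line of
  \<open>ln\<close> at \<open>C\<close>. Data processing and single-letterization both use concavity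
  only through it.\<close>

lemma expectation_log_le:
  fixes g :: "'a \<Rightarrow> real"
  assumes fin: "finite (set_pmf M)" and C: "C > 0"
    and pos: "\<And>t. t \<in> set_pmf M \<Longrightarrow> g t > 0"
    and le: "measure_pmf.expectation M g \<le> C"
  shows "measure_pmf.expectation M (\<lambda>t. log 2 (g t)) \<le> log 2 C"
proof -
  note [simp] = integrable_measure_pmf_finite[OF fin]
  have "measure_pmf.expectation M (\<lambda>t. log 2 (g t))
      \<le> measure_pmf.expectation M (\<lambda>t. log 2 C + (g t / C - 1) / ln 2)"
  proof (rule expectation_mono_pmf[OF fin])
    fix t assume "t \<in> set_pmf M"
    with pos have g: "g t > 0" by blast
    have "ln (g t) - ln C \<le> g t / C - 1"
      using ln_le_minus_one[of "g t / C"] g C by (simp add: ln_div)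
    then have "(ln (g t) - ln C) / ln 2 \<le> (g t / C - 1) / ln 2"
      by (intro divide_right_mono) auto
    then show "log 2 (g t) \<le> log 2 C + (g t / C - 1) / ln 2"
      by (simp add: log_def diff_divide_distrib)
  qed
  also have "\<dots> = log 2 C + (measure_pmf.expectation M g / C - 1) / ln 2"
    by simp
  also have "\<dots> \<le> log 2 C"
    using le C by (simp add: divide_nonpos_pos)
  finally show ?thesis .
qed

lemma pmf_map_pos: "t \<in> set_pmf M \<Longrightarrow> pmf (map_pmf f M) (f t) > 0"
  by (simp add: pmf_positive)

text \<open>Two atoms agree if they pull back to the same event up to a null set. This allows tuples
  to be reordered, or stripped of redundant components, without computing sums.\<close>

lemma pmf_map_eqI:
  assumes "\<And>t. t \<in> set_pmf M \<Longrightarrow> f t = a \<longleftrightarrow> g t = b"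
  shows "pmf (map_pmf f M) a = pmf (map_pmf g M) b"
  unfolding pmf_map
  by (rule measure_pmf.finite_measure_eq_AE) (use assms in \<open>auto simp: AE_measure_pmf_iff\<close>)

text \<open>Random-variable form: \<open>M\<close> is the sample space, and \<open>cmi\<close>
  becomes the mean of a log density ratio on it. Several informations can thus be compared pointwise
  under one expectation.\<close>

lemma cmi_map:
  fixes A :: "'t \<Rightarrow> 'a" and B :: "'t \<Rightarrow> 'b" and C :: "'t \<Rightarrow> 'c"
  assumes "finite (set_pmf M)"
  shows "cmi (map_pmf (\<lambda>t. (A t, B t, C t)) M) = measure_pmf.expectation M (\<lambda>t. log 2
     (pmf (map_pmf (\<lambda>t. (A t, B t, C t)) M) (A t, B t, C t) * pmf (map_pmf C M) (C t)
       / (pmf (map_pmf (\<lambda>t. (A t, C t)) M) (A t, C t) * pmf (map_pmf (\<lambda>t. (B t, C t)) M) (B t, C t))))"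
proof -
  let ?J = "map_pmf (\<lambda>t. (A t, B t, C t)) M"
  have fin: "finite (set_pmf ?J)"
    using assms by simp
  have "cmi ?J = measure_pmf.expectation ?J (\<lambda>(a, b, c). log 2 (pmf ?J (a, b, c) * pmf (map_pmf (\<lambda>(a, b, c). c) ?J) c
        / (pmf (map_pmf (\<lambda>(a, b, c). (a, c)) ?J) (a, c) * pmf (map_pmf (\<lambda>(a, b, c). (b, c)) ?J) (b, c))))"
    unfolding expectation_finite[OF fin] cmi_def by (intro sum.cong) auto
  then show ?thesis
    by (simp add: map_pmf_comp)
qed

lemma cmi_map_commute:
  assumes "finite (set_pmf M)"
  shows "cmi (map_pmf (\<lambda>t. (A t, B t, C t)) M) = cmi (map_pmf (\<lambda>t. (B t, A t, C t)) M)"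
proof -
  have "pmf (map_pmf (\<lambda>t. (A t, B t, C t)) M) (A s, B s, C s)
      = pmf (map_pmf (\<lambda>t. (B t, A t, C t)) M) (B s, A s, C s)" for s
    by (rule pmf_map_eqI) auto
  then show ?thesis
    unfolding cmi_map[OF assms] by (simp add: mult.commute)
qed

text \<open>An injective relabelling changes no atom. It serves to encode an auxiliary variable of
  countable type by natural numbers, the type fixed in \<open>region_s_minus_gamma\<close>.\<close>

lemma cmi_map_inj:
  assumes "finite (set_pmf M)" "inj \<phi>"
  shows "cmi (map_pmf (\<lambda>t. (A t, \<phi> (B t), C t)) M) = cmi (map_pmf (\<lambda>t. (A t, B t, C t)) M)"
proof -
  have 1: "pmf (map_pmf (\<lambda>t. (A t, \<phi> (B t), C t)) M) (A s, \<phi> (B s), C s)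
      = pmf (map_pmf (\<lambda>t. (A t, B t, C t)) M) (A s, B s, C s)" for s
    by (rule pmf_map_eqI) (auto dest: injD[OF assms(2)])
  have 2: "pmf (map_pmf (\<lambda>t. (\<phi> (B t), C t)) M) (\<phi> (B s), C s)
      = pmf (map_pmf (\<lambda>t. (B t, C t)) M) (B s, C s)" for s
    by (rule pmf_map_eqI) (auto dest: injD[OF assms(2)])
  show ?thesis
    unfolding cmi_map[OF assms(1)] 1 2 ..
qed

section \<open>Data processing and Markov kernels\<close>

lemma sum_pmf_le_marginal:
  assumes "finite B"
  shows "(\<Sum>b\<in>B. pmf K (b, c)) \<le> pmf (map_pmf snd K) c"
proof -
  have "(\<Sum>b\<in>B. pmf K (b, c)) = (\<Sum>t\<in>(\<lambda>b. (b, c)) ` B. pmf K t)"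
    by (subst sum.reindex) (auto simp: inj_on_def)
  also have "\<dots> = measure_pmf.prob K ((\<lambda>b. (b, c)) ` B)"
    using assms by (simp add: measure_measure_pmf_finite)
  also have "\<dots> \<le> pmf (map_pmf snd K) c"
    unfolding pmf_map by (intro measure_pmf.finite_measure_mono) auto
  finally show ?thesis .
qed

text \<open>The atoms of the joint law cancel, leaving the sum over its support of the law that
  makes \<open>A\<close> and \<open>B\<close> conditionally independent given \<open>C\<close>. The
  support may miss part of that law, hence an inequality.\<close>

lemma expectation_indep_ratio_le_1:
  fixes A :: "'t \<Rightarrow> 'a" and B :: "'t \<Rightarrow> 'b" and C :: "'t \<Rightarrow> 'c"
  assumes fin: "finite (set_pmf M)"
  shows "measure_pmf.expectation M (\<lambda>t. pmf (map_pmf (\<lambda>t. (A t, C t)) M) (A t, C t)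
       * pmf (map_pmf (\<lambda>t. (B t, C t)) M) (B t, C t)
       / (pmf (map_pmf C M) (C t) * pmf (map_pmf (\<lambda>t. (A t, B t, C t)) M) (A t, B t, C t))) \<le> 1"
proof -
  let ?J = "map_pmf (\<lambda>t. (A t, B t, C t)) M"
  let ?AC = "map_pmf (\<lambda>t. (A t, C t)) M" and ?BC = "map_pmf (\<lambda>t. (B t, C t)) M" and ?C = "map_pmf C M"
  define g where "g = (\<lambda>(a, b, c). pmf ?AC (a, c) * pmf ?BC (b, c) / pmf ?C c)"
  have finJ: "finite (set_pmf ?J)" using fin by simp
  have "measure_pmf.expectation M (\<lambda>t. pmf ?AC (A t, C t) * pmf ?BC (B t, C t)
       / (pmf ?C (C t) * pmf ?J (A t, B t, C t))) = measure_pmf.expectation ?J (\<lambda>s. g s / pmf ?J s)"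
    by (simp add: g_def)
  also have "\<dots> = (\<Sum>s\<in>set_pmf ?J. g s)"
    unfolding expectation_finite[OF finJ] by (intro sum.cong refl) (simp add: set_pmf_iff del: set_map_pmf)
  also have "\<dots> = (\<Sum>((a, c), b)\<in>(\<lambda>(a, b, c). ((a, c), b)) ` set_pmf ?J. g (a, b, c))"
    by (subst sum.reindex) (auto simp: inj_on_def intro!: sum.cong)
  also have "\<dots> \<le> (\<Sum>((a, c), b)\<in>set_pmf ?AC \<times> B ` set_pmf M. g (a, b, c))"
    using fin by (intro sum_mono2) (auto simp: g_def)
  also have "\<dots> = (\<Sum>(a, c)\<in>set_pmf ?AC. \<Sum>b\<in>B ` set_pmf M. g (a, b, c))"
    by (subst sum.cartesian_product[symmetric]) (auto intro!: sum.cong)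
  also have "\<dots> = (\<Sum>(a, c)\<in>set_pmf ?AC. pmf ?AC (a, c) * ((\<Sum>b\<in>B ` set_pmf M. pmf ?BC (b, c)) / pmf ?C c))"
    by (intro sum.cong refl) (auto simp: g_def sum_distrib_left sum_divide_distrib)
  also have "\<dots> \<le> (\<Sum>(a, c)\<in>set_pmf ?AC. pmf ?AC (a, c) * 1)"
  proof (rule sum_mono, clarify)
    fix a c
    have "map_pmf snd ?BC = ?C" by (simp add: map_pmf_comp)
    then have "(\<Sum>b\<in>B ` set_pmf M. pmf ?BC (b, c)) \<le> pmf ?C c"
      using sum_pmf_le_marginal[of "B ` set_pmf M" ?BC c] fin by simp
    \<comment> \<open>Where \<open>pmf ?C c = 0\<close> the quotient is 0 by the division
      convention.\<close>
    then have "(\<Sum>b\<in>B ` set_pmf M. pmf ?BC (b, c)) / pmf ?C c \<le> 1"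
      by (cases "pmf ?C c = 0") (simp_all add: pmf_nonneg order.strict_iff_order)
    then show "pmf ?AC (a, c) * ((\<Sum>b\<in>B ` set_pmf M. pmf ?BC (b, c)) / pmf ?C c) \<le> pmf ?AC (a, c) * 1"
      by (intro mult_left_mono) auto
  qed
  also have "\<dots> = 1"
    using sum_pmf_eq_1[of "set_pmf ?AC" ?AC] fin by (simp add: case_prod_unfold)
  finally show ?thesis .
qed

text \<open>In information terms the difference of the two sides is \<open>-I(A;B|C,Z)\<close>: by
  the Markov property the quotient \<open>q\<close> of the two density ratios is the independence
  ratio of \<open>A\<close> and \<open>B\<close> given \<open>(C, Z)\<close>, whose mean is at most
  1.\<close>

lemma data_processing:
  assumes fin: "finite (set_pmf M)"
    and ci: "cond_indep (map_pmf (\<lambda>t. (A t, C t, (B t, Z t))) M)"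
  shows "cmi (map_pmf (\<lambda>t. (A t, C t, Z t)) M) \<le> cmi (map_pmf (\<lambda>t. (A t, B t, Z t)) M)"
proof -
  note [simp] = integrable_measure_pmf_finite[OF fin]
  define r where "r t = pmf (map_pmf (\<lambda>t. (A t, C t, Z t)) M) (A t, C t, Z t) * pmf (map_pmf Z M) (Z t)
       / (pmf (map_pmf (\<lambda>t. (A t, Z t)) M) (A t, Z t) * pmf (map_pmf (\<lambda>t. (C t, Z t)) M) (C t, Z t))" for t
  define s where "s t = pmf (map_pmf (\<lambda>t. (A t, B t, Z t)) M) (A t, B t, Z t) * pmf (map_pmf Z M) (Z t)
       / (pmf (map_pmf (\<lambda>t. (A t, Z t)) M) (A t, Z t) * pmf (map_pmf (\<lambda>t. (B t, Z t)) M) (B t, Z t))" for t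
  define q where "q t = pmf (map_pmf (\<lambda>t. (A t, C t, Z t)) M) (A t, C t, Z t)
       * pmf (map_pmf (\<lambda>t. (B t, C t, Z t)) M) (B t, C t, Z t)
       / (pmf (map_pmf (\<lambda>t. (C t, Z t)) M) (C t, Z t)
          * pmf (map_pmf (\<lambda>t. (A t, B t, C t, Z t)) M) (A t, B t, C t, Z t))" for t
  have rs: "r t > 0" "s t > 0" "r t / s t = q t" if t: "t \<in> set_pmf M" for t
  proof -
    note p = pmf_map_pos[OF t]
    have ci': "pmf (map_pmf (\<lambda>t. (A t, C t, (B t, Z t))) M) (A t, C t, B t, Z t)
        * pmf (map_pmf (\<lambda>t. (B t, Z t)) M) (B t, Z t)
       = pmf (map_pmf (\<lambda>t. (A t, B t, Z t)) M) (A t, B t, Z t)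
        * pmf (map_pmf (\<lambda>t. (C t, B t, Z t)) M) (C t, B t, Z t)"
      using ci unfolding cond_indep_def by (simp add: map_pmf_comp)
    have sw1: "pmf (map_pmf (\<lambda>t. (A t, C t, (B t, Z t))) M) (A t, C t, B t, Z t)
        = pmf (map_pmf (\<lambda>t. (A t, B t, C t, Z t)) M) (A t, B t, C t, Z t)"
      by (rule pmf_map_eqI) auto
    have sw2: "pmf (map_pmf (\<lambda>t. (C t, B t, Z t)) M) (C t, B t, Z t)
        = pmf (map_pmf (\<lambda>t. (B t, C t, Z t)) M) (B t, C t, Z t)"
      by (rule pmf_map_eqI) auto
    note p' = p[of Z] p[of "\<lambda>t. (A t, Z t)"] p[of "\<lambda>t. (B t, Z t)"] p[of "\<lambda>t. (C t, Z t)"]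
      p[of "\<lambda>t. (A t, C t, Z t)"] p[of "\<lambda>t. (A t, B t, Z t)"] p[of "\<lambda>t. (B t, C t, Z t)"]
      p[of "\<lambda>t. (A t, B t, C t, Z t)"]
    show "r t > 0" "s t > 0"
      unfolding r_def s_def using p' by (auto intro!: divide_pos_pos mult_pos_pos)
    show "r t / s t = q t"
      unfolding r_def s_def q_def using p' ci'[unfolded sw1 sw2]
      by (simp add: field_simps)
  qed
  have "cmi (map_pmf (\<lambda>t. (A t, C t, Z t)) M) - cmi (map_pmf (\<lambda>t. (A t, B t, Z t)) M)
     = measure_pmf.expectation M (\<lambda>t. log 2 (r t) - log 2 (s t))"
    unfolding cmi_map[OF fin] r_def s_def by simp
  also have "\<dots> = measure_pmf.expectation M (\<lambda>t. log 2 (q t))"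
  proof (rule expectation_cong_pmf)
    fix t assume t: "t \<in> set_pmf M"
    show "log 2 (r t) - log 2 (s t) = log 2 (q t)"
      unfolding rs(3)[OF t, symmetric] using rs(1,2)[OF t] by (simp add: log_divide)
  qed
  also have "\<dots> \<le> log 2 1"
  proof (rule expectation_log_le[OF fin])
    show "q t > 0" if "t \<in> set_pmf M" for t
      using rs[OF that] divide_pos_pos by metis
    show "measure_pmf.expectation M q \<le> 1"
      unfolding q_def[abs_def]
      by (rule expectation_indep_ratio_le_1[OF fin, of A "\<lambda>t. (C t, Z t)" B])
  qed simp
  finally show ?thesis by simp
qed

text \<open>As \<open>b\<close> is drawn from a kernel that sees only \<open>c\<close>, the joint
  mass is \<open>pmf (W c) b\<close> times the mass of \<open>(a, c)\<close>. Every Markov property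
  used for data processing comes from here.\<close>

lemma cond_indep_kernel:
  fixes L :: "('a \<times> 'c) pmf" and W :: "'c \<Rightarrow> 'b pmf"
  shows "cond_indep (bind_pmf L (\<lambda>(a, c). map_pmf (\<lambda>b. (a, b, c)) (W c)))" (is "cond_indep ?J")
  unfolding cond_indep_def
proof (intro allI)
  fix a :: 'a and b :: 'b and c :: 'c
  have marg: "map_pmf (\<lambda>(a, b, c). c) ?J = map_pmf snd L" "map_pmf (\<lambda>(a, b, c). (a, c)) ?J = L"
    by (simp_all add: map_bind_pmf map_pmf_comp case_prod_unfold map_pmf_const bind_return_pmf' flip: map_pmf_def)
  have bc: "map_pmf (\<lambda>(a, b, c). (b, c)) ?J = bind_pmf (map_pmf snd L) (\<lambda>c. map_pmf (\<lambda>b. (b, c)) (W c))"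
    by (simp add: map_bind_pmf bind_map_pmf map_pmf_comp case_prod_unfold)
  have k1: "pmf (map_pmf (\<lambda>b. (a', b, c')) (W c')) (a, b, c)
      = pmf (W c) b * indicator {(a, c)} (a', c')" for a' c'
    by (cases "(a', c') = (a, c)")
       (auto simp: pmf_map_inj'[of "\<lambda>b. (a, b, c)"] inj_on_def pmf_eq_0_set_pmf)
  have k2: "pmf (map_pmf (\<lambda>b. (b, c')) (W c')) (b, c) = pmf (W c) b * indicator {c} c'" for c'
    by (cases "c' = c") (auto simp: pmf_map_inj'[of "\<lambda>b. (b, c)"] inj_on_def pmf_eq_0_set_pmf)
  have 1: "pmf ?J (a, b, c) = pmf (W c) b * pmf L (a, c)"
    unfolding pmf_bind by (simp add: case_prod_unfold k1 measure_pmf_single)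
  have 2: "pmf (map_pmf (\<lambda>(a, b, c). (b, c)) ?J) (b, c) = pmf (W c) b * pmf (map_pmf snd L) c"
    unfolding bc pmf_bind by (simp only: k2) (simp add: measure_pmf_single del: integral_map_pmf)
  show "pmf ?J (a, b, c) * pmf (map_pmf (\<lambda>(a, b, c). c) ?J) c
      = pmf (map_pmf (\<lambda>(a, b, c). (a, c)) ?J) (a, c) * pmf (map_pmf (\<lambda>(a, b, c). (b, c)) ?J) (b, c)"
    unfolding 2 unfolding 1 marg by simp
qed

section \<open>Single-letterization\<close>

lemma finite_lists_length [simp]: "finite {xs :: 'a::finite list. length xs = n}"
  using finite_lists_length_eq[of "UNIV :: 'a set" n] by simp

lemma lists_length_Suc: "{xs. length xs = Suc n} = (\<lambda>(a, xs). a # xs) ` (UNIV \<times> {xs. length xs = n})"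
  by (auto simp: image_iff length_Suc_conv)

text \<open>Distributivity, by splitting off the head of the list. It turns sums over sequences into
  products of single-letter sums, for the single-letter bound as well as for the Bhattacharyya
  coefficient.\<close>

lemma sum_lists_prod:
  fixes f :: "nat \<Rightarrow> 'a::finite \<Rightarrow> real"
  shows "(\<Sum>xs | length xs = n. \<Prod>i<n. f i (xs ! i)) = (\<Prod>i<n. \<Sum>a\<in>UNIV. f i a)"
proof (induction n arbitrary: f)
  case (Suc n)
  have "(\<Sum>xs | length xs = Suc n. \<Prod>i<Suc n. f i (xs ! i))
      = (\<Sum>(a, xs)\<in>UNIV \<times> {xs. length xs = n}. f 0 a * (\<Prod>i<n. f (Suc i) (xs ! i)))"
    unfolding lists_length_Suc
    by (subst sum.reindex) (auto simp: inj_on_def prod.lessThan_Suc_shift simp del: prod.lessThan_Suc intro!: sum.cong)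
  also have "\<dots> = (\<Sum>a\<in>UNIV. f 0 a) * (\<Sum>xs | length xs = n. \<Prod>i<n. f (Suc i) (xs ! i))"
    by (simp add: sum_product sum.cartesian_product)
  also have "\<dots> = (\<Prod>i<Suc n. \<Sum>a\<in>UNIV. f i a)"
    unfolding prod.lessThan_Suc_shift Suc.IH[of "\<lambda>i. f (Suc i)"] ..
  finally show ?case .
qed simp

lemma replicate_pmf_Suc_pair:
  "replicate_pmf (Suc n) p = map_pmf (\<lambda>(x, xs). x # xs) (pair_pmf p (replicate_pmf n p))"
  by (simp add: pair_pmf_def map_bind_pmf)

lemma pmf_replicate:
  "length xs = n \<Longrightarrow> pmf (replicate_pmf n p) xs = (\<Prod>i<n. pmf p (xs ! i))"
proof (induction n arbitrary: xs)
  case (Suc n)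
  then obtain y ys where xs: "xs = y # ys" "length ys = n"
    by (auto simp: length_Suc_conv)
  have "pmf (replicate_pmf (Suc n) p) xs = pmf (pair_pmf p (replicate_pmf n p)) (y, ys)"
    unfolding replicate_pmf_Suc_pair xs
    using pmf_map_inj'[of "\<lambda>(x, xs). x # xs" "pair_pmf p (replicate_pmf n p)" "(y, ys)"]
    by (auto simp: inj_def)
  then show ?case
    using Suc.IH[OF xs(2)] by (simp add: pmf_pair xs prod.lessThan_Suc_shift del: replicate_pmf.simps prod.lessThan_Suc)
qed simp

lemma map_replicate_pmf:
  "map_pmf (map f) (replicate_pmf n p) = replicate_pmf n (map_pmf f p)"
proof (induction n)
  case (Suc n)
  show ?case
    by (simp add: map_bind_pmf bind_map_pmf Suc.IH[symmetric])
qed simp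

lemma map_nth_replicate_pmf:
  "i < n \<Longrightarrow> map_pmf (\<lambda>xs. xs ! i) (replicate_pmf n p) = p"
proof (induction n arbitrary: i)
  case (Suc n)
  show ?case
  proof (cases i)
    case 0
    then show ?thesis by (simp add: map_bind_pmf bind_return_pmf')
  next
    case (Suc j)
    then have "map_pmf (\<lambda>xs. xs ! j) (replicate_pmf n p) = p"
      using Suc.IH[of j] Suc.prems by simp
    then show ?thesis
      using Suc by (simp add: map_bind_pmf) (simp add: map_pmf_def)
  qed
qed simp

lemma set_replicate_pmf_length: "xs \<in> set_pmf (replicate_pmf n p) \<Longrightarrow> length xs = n"
  by (simp add: set_replicate_pmf)

lemma sum_zip:
  fixes F :: "('a::finite \<times> 'z::finite) list \<Rightarrow> real"
  shows "(\<Sum>azs | length azs = n. F azs)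
      = (\<Sum>zs | length zs = n. \<Sum>as | length as = n. F (zip as zs))"
proof -
  have "{azs :: ('a \<times> 'z) list. length azs = n}
      = (\<lambda>(zs, as). zip as zs) ` ({zs. length zs = n} \<times> {as. length as = n})"
  proof (auto simp: image_iff, goal_cases)
    case (1 azs)
    show ?case
      by (rule exI[of _ "map snd azs"], simp, rule exI[of _ "map fst azs"]) (simp add: zip_map_fst_snd)
  qed
  moreover have "inj_on (\<lambda>(zs, as). zip as zs) ({zs :: 'z list. length zs = n} \<times> {as :: 'a list. length as = n})"
    by (rule inj_on_inverseI[where g = "\<lambda>l. (map snd l, map fst l)"]) auto
  ultimately show ?thesis
    by (simp add: sum.reindex case_prod_unfold sum.cartesian_product)
qed

text \<open>The component \<open>(m, z\<^sup>n, i)\<close> is the auxiliary variable \<open>U\<close>; keeping all of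
  \<open>z\<^sup>n\<close> in it, including the letter \<open>z\<^sub>i\<close>, does not change \<open>I(A;U|Z)\<close>.\<close>

definition single_letter ::
  "nat \<Rightarrow> (('a \<times> 'z) list \<times> 'm) pmf \<Rightarrow> ('a \<times> ('m \<times> 'z list \<times> nat) \<times> 'z) pmf" where
  "single_letter n L = map_pmf (\<lambda>((azs, m), i). (fst (azs ! i), (m, map snd azs, i), snd (azs ! i)))
     (pair_pmf L (pmf_of_set {..<n}))"

lemma pair_pmf_bind: "map_pmf h (pair_pmf L U) = bind_pmf U (\<lambda>j. map_pmf (\<lambda>t. h (t, j)) L)"
  unfolding pair_pmf_def map_bind_pmf
  by (subst bind_commute_pmf) (simp add: map_pmf_def bind_return_pmf)

text \<open>The value \<open>v\<close> reveals the time index, so only one component of the mixture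
  over \<open>j\<close> contributes.\<close>

lemma pmf_map_pair_tagged:
  assumes "\<And>t j. h (t, j) = v \<Longrightarrow> j = i"
  shows "pmf (map_pmf h (pair_pmf L U)) v = pmf U i * pmf (map_pmf (\<lambda>t. h (t, i)) L) v"
proof -
  have "pmf (map_pmf (\<lambda>t. h (t, j)) L) v = 0" if "j \<noteq> i" for j
    using assms that by (auto simp: pmf_eq_0_set_pmf)
  then show ?thesis
    unfolding pair_pmf_bind pmf_bind
    by (subst integral_measure_pmf_real[of "{i}"]) auto
qed

lemma map_nth_marginal:
  assumes "i < n" "map_pmf fst L = replicate_pmf n Q"
  shows "map_pmf (\<lambda>(azs, m). azs ! i) L = Q"
proof -
  have "map_pmf (\<lambda>(azs, m). azs ! i) L = map_pmf (\<lambda>xs. xs ! i) (map_pmf fst L)"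
    by (simp add: map_pmf_comp case_prod_unfold)
  then show ?thesis using assms by (simp add: map_nth_replicate_pmf)
qed

text \<open>Every position has law \<open>Q\<close>, hence so has the uniform mixture over
  positions.\<close>

lemma single_letter_marginal:
  assumes n: "n > 0" and marg: "map_pmf fst L = replicate_pmf n Q"
  shows "map_pmf (\<lambda>(a, u, z). (a, z)) (single_letter n L) = Q"
proof -
  have ne: "{..<n} \<noteq> {}" using n by auto
  have "map_pmf (\<lambda>(a, u, z). (a, z)) (single_letter n L)
      = bind_pmf (pmf_of_set {..<n}) (\<lambda>j. map_pmf (\<lambda>(azs, m). azs ! j) L)"
    unfolding single_letter_def map_pmf_comp pair_pmf_bind by (simp add: case_prod_unfold map_bind_pmf map_pmf_comp)
  also have "\<dots> = bind_pmf (pmf_of_set {..<n}) (\<lambda>j. Q)"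
    using ne by (intro bind_pmf_cong refl map_nth_marginal[OF _ marg]) simp
  finally show ?thesis by simp
qed

lemma expectation_pair_uniform:
  fixes F :: "'t \<times> nat \<Rightarrow> real"
  assumes "finite (set_pmf L)" "n > 0"
  shows "measure_pmf.expectation (pair_pmf L (pmf_of_set {..<n})) F
       = measure_pmf.expectation L (\<lambda>t. \<Sum>i<n. F (t, i)) / n"
proof -
  have ne: "{..<n} \<noteq> {}" using assms(2) by auto
  have "measure_pmf.expectation (pair_pmf L (pmf_of_set {..<n})) F
      = (\<Sum>(t, i)\<in>set_pmf L \<times> {..<n}. pmf L t * (1 / n) * F (t, i))"
    using assms by (subst expectation_finite) (auto simp: set_pmf_of_set[OF ne] pmf_pair pmf_of_set[OF ne] intro!: sum.cong)
  also have "\<dots> = (\<Sum>t\<in>set_pmf L. pmf L t * (\<Sum>i<n. F (t, i))) / n"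
    by (simp add: sum.cartesian_product[symmetric] sum_distrib_left sum_divide_distrib)
  finally show ?thesis
    using assms by (simp add: expectation_finite)
qed

text \<open>\<open>n I(A;U|Z)\<close> is the expectation of the logarithm of \<open>\<Prod>i. P(a\<^sub>i | m, z\<^sup>n) / Q(a\<^sub>i | z\<^sub>i)\<close>. After one use of
  Jensen's inequality the numerator is summed over \<open>a\<^sup>n\<close> as a product of conditional distributions, and
  every \<open>m\<close> contributes at most \<open>c\<close>.\<close>

lemma single_letter_cmi_le:
  fixes L :: "(('a::finite \<times> 'z::finite) list \<times> 'm) pmf"
  assumes n: "n > 0" and marg: "map_pmf fst L = replicate_pmf n Q"
    and S: "finite S" "snd ` set_pmf L \<subseteq> S"
    and c: "c > 0" "\<And>azs m. pmf L (azs, m) \<le> c * pmf (replicate_pmf n Q) azs"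
  shows "real n * cmi (single_letter n L) \<le> log 2 (c * real (card S))"
proof -
  let ?U = "pmf_of_set {..<n}" and ?Qz = "map_pmf snd Q"
  let ?M = "pair_pmf L ?U"
  have ne: "{..<n} \<noteq> {}" using n by auto
  have len: "length azs = n" if "(azs, m) \<in> set_pmf L" for azs m
  proof -
    have "azs \<in> set_pmf (map_pmf fst L)" using that by (force simp: image_iff)
    then show ?thesis unfolding marg by (rule set_replicate_pmf_length)
  qed
  have sub: "set_pmf L \<subseteq> {azs. length azs = n} \<times> S"
    using len S(2) by force
  have finL: "finite (set_pmf L)"
    using S(1) by (intro finite_subset[OF sub]) simp
  have finM: "finite (set_pmf ?M)" using finL ne by simp
  note Qi = map_nth_marginal[OF _ marg]
  have pQ: "pmf Q (azs ! i) > 0" if "(azs, m) \<in> set_pmf L" "i < n" for azs m i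
    using pmf_map_pos[OF that(1), of "\<lambda>(azs, m). azs ! i"] Qi[OF that(2)] by simp
  \<comment> \<open>The quotient of \<open>w\<close> by \<open>v\<close> is the conditional
    probability of letter \<open>a\<close> at time \<open>i\<close> given \<open>(m, z^n)\<close>;
    \<open>r\<close> is its ratio to the conditional probability of that letter given
    \<open>z_i\<close> alone.\<close>
  define w where "w i a m zs = pmf (map_pmf (\<lambda>(azs, m). (fst (azs ! i), m, map snd azs)) L) (a, m, zs)" for i a m zs
  define v where "v m zs = pmf (map_pmf (\<lambda>(azs, m). (m, map snd azs)) L) (m, zs)" for m zs
  define r where "r i azs m = w i (fst (azs ! i)) m (map snd azs) / v m (map snd azs)
      * pmf ?Qz (snd (azs ! i)) / pmf Q (azs ! i)" for i azs m
  have vpos: "v m (map snd azs) > 0" if "(azs, m) \<in> set_pmf L" for azs m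
    using pmf_map_pos[OF that, of "\<lambda>(azs, m). (m, map snd azs)"] by (simp add: v_def)
  have wpos: "w i (fst (azs ! i)) m (map snd azs) > 0" if "(azs, m) \<in> set_pmf L" for azs m i
    using pmf_map_pos[OF that, of "\<lambda>(azs, m). (fst (azs ! i), m, map snd azs)"] by (simp add: w_def)
  have rpos: "r i azs m > 0" if "(azs, m) \<in> set_pmf L" "i < n" for azs m i
  proof -
    have "pmf ?Qz (snd (azs ! i)) > 0"
      by (rule pmf_map_pos) (use pQ[OF that] in \<open>simp add: set_pmf_iff\<close>)
    then show ?thesis
      unfolding r_def using vpos wpos pQ that by (simp)
  qed
  \<comment> \<open>Only a bound by 1 is claimed: where \<open>v m zs = 0\<close> the quotients are
    0 by convention.\<close>
  have wv: "(\<Sum>a\<in>UNIV. w i a m zs / v m zs) \<le> 1" for i m zs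
  proof -
    have "(\<Sum>a\<in>UNIV. w i a m zs) \<le> v m zs"
      using sum_pmf_le_marginal[of "UNIV :: 'a set" "map_pmf (\<lambda>(azs, m). (fst (azs ! i), m, map snd azs)) L" "(m, zs)"]
      by (simp add: w_def v_def map_pmf_comp case_prod_unfold)
    moreover have "v m zs \<ge> 0" by (simp add: v_def)
    ultimately show ?thesis
      by (cases "v m zs = 0") (simp_all add: sum_divide_distrib[symmetric])
  qed
  let ?A = "\<lambda>((azs, m), i). fst (azs ! i) :: 'a" and ?B = "\<lambda>((azs, m), i). (m :: 'm, map snd azs :: 'z list, i :: nat)"
    and ?C = "\<lambda>((azs, m), i). snd (azs ! i) :: 'z"
  have sl: "single_letter n L = map_pmf (\<lambda>t. (?A t, ?B t, ?C t)) ?M"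
    by (simp add: single_letter_def case_prod_unfold)
  have dens: "pmf (map_pmf (\<lambda>t. (?A t, ?B t, ?C t)) ?M) (?A t, ?B t, ?C t) * pmf (map_pmf ?C ?M) (?C t)
       / (pmf (map_pmf (\<lambda>t. (?A t, ?C t)) ?M) (?A t, ?C t) * pmf (map_pmf (\<lambda>t. (?B t, ?C t)) ?M) (?B t, ?C t))
     = r i azs m" if t: "t = ((azs, m), i)" "(azs, m) \<in> set_pmf L" "i < n" for t azs m i
  proof -
    have AC: "map_pmf (\<lambda>t. (?A t, ?C t)) ?M = Q"
      using single_letter_marginal[OF n marg] unfolding sl by (simp add: map_pmf_comp case_prod_unfold)
    have zi: "snd (azs' ! i) = snd (azs ! i)" if "(azs', m') \<in> set_pmf L" "map snd azs' = map snd azs" for azs' m'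
      using arg_cong[OF that(2), of "\<lambda>zs. zs ! i"] len[OF that(1)] len[OF t(2)] t(3) by simp
    have "map_pmf ?C ?M = map_pmf snd (map_pmf (\<lambda>t. (?A t, ?C t)) ?M)"
      by (simp add: map_pmf_comp)
    then have C: "map_pmf ?C ?M = ?Qz" unfolding AC .
    have u: "pmf ?U i = 1 / n" using t(3) ne by simp
    have ABC: "pmf (map_pmf (\<lambda>t. (?A t, ?B t, ?C t)) ?M) (?A t, ?B t, ?C t) = 1 / n * w i (fst (azs ! i)) m (map snd azs)"
    proof -
      have "pmf (map_pmf (\<lambda>t. (?A t, ?B t, ?C t)) ?M) (?A t, ?B t, ?C t)
         = 1 / n * pmf (map_pmf (\<lambda>(azs, m). (fst (azs ! i), (m, map snd azs, i), snd (azs ! i))) L)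
              (fst (azs ! i), (m, map snd azs, i), snd (azs ! i))"
        by (subst pmf_map_pair_tagged[of _ _ i]) (auto simp: u t(1) case_prod_unfold)
      also have "pmf (map_pmf (\<lambda>(azs, m). (fst (azs ! i), (m, map snd azs, i), snd (azs ! i))) L)
              (fst (azs ! i), (m, map snd azs, i), snd (azs ! i)) = w i (fst (azs ! i)) m (map snd azs)"
        unfolding w_def using zi by (intro pmf_map_eqI) auto
      finally show ?thesis .
    qed
    have BC: "pmf (map_pmf (\<lambda>t. (?B t, ?C t)) ?M) (?B t, ?C t) = 1 / n * v m (map snd azs)"
    proof -
      have "pmf (map_pmf (\<lambda>t. (?B t, ?C t)) ?M) (?B t, ?C t)
         = 1 / n * pmf (map_pmf (\<lambda>(azs, m). ((m, map snd azs, i), snd (azs ! i))) L)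
              ((m, map snd azs, i), snd (azs ! i))"
        by (subst pmf_map_pair_tagged[of _ _ i]) (auto simp: u t(1) case_prod_unfold)
      also have "pmf (map_pmf (\<lambda>(azs, m). ((m, map snd azs, i), snd (azs ! i))) L)
              ((m, map snd azs, i), snd (azs ! i)) = v m (map snd azs)"
        unfolding v_def using zi by (intro pmf_map_eqI) auto
      finally show ?thesis .
    qed
    show ?thesis
      unfolding AC C ABC BC r_def using n by (simp add: t(1) field_simps)
  qed
  have "cmi (single_letter n L) = measure_pmf.expectation ?M (\<lambda>((azs, m), i). log 2 (r i azs m))"
    unfolding sl cmi_map[OF finM]
  proof (rule expectation_cong_pmf)
    fix t assume t: "t \<in> set_pmf ?M"
    obtain azs m i where tt: "t = ((azs, m), i)" by (metis surj_pair)
    have "(azs, m) \<in> set_pmf L" "i < n" using t ne by (simp_all add: tt)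
    note d = dens[OF tt this]
    show "log 2 (pmf (map_pmf (\<lambda>t. (?A t, ?B t, ?C t)) ?M) (?A t, ?B t, ?C t) * pmf (map_pmf ?C ?M) (?C t)
       / (pmf (map_pmf (\<lambda>t. (?A t, ?C t)) ?M) (?A t, ?C t) * pmf (map_pmf (\<lambda>t. (?B t, ?C t)) ?M) (?B t, ?C t)))
      = (\<lambda>((azs, m), i). log 2 (r i azs m)) t"
      unfolding d by (simp add: tt)
  qed
  also have "\<dots> = measure_pmf.expectation L (\<lambda>(azs, m). \<Sum>i<n. log 2 (r i azs m)) / n"
    by (subst expectation_pair_uniform[OF finL n]) (simp add: case_prod_unfold)
  also have "\<dots> = measure_pmf.expectation L (\<lambda>t. log 2 (case t of (azs, m) \<Rightarrow> \<Prod>i<n. r i azs m)) / n"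
  proof (rule arg_cong[where f = "\<lambda>x. x / real n"], rule expectation_cong_pmf, clarify)
    fix azs m assume "(azs, m) \<in> set_pmf L"
    then have "r i azs m \<noteq> 0" if "i < n" for i
      using rpos that by (metis less_irrefl)
    then show "(\<Sum>i<n. log 2 (r i azs m)) = log 2 (\<Prod>i<n. r i azs m)"
      by (subst log_def, subst ln_prod) (auto simp: log_def sum_divide_distrib)
  qed
  finally have "real n * cmi (single_letter n L)
     = measure_pmf.expectation L (\<lambda>t. log 2 (case t of (azs, m) \<Rightarrow> \<Prod>i<n. r i azs m))"
    using n by simp
  also have "\<dots> \<le> log 2 (c * real (card S))"
  proof (rule expectation_log_le[OF finL])
    have "S \<noteq> {}" using S(2) set_pmf_not_empty[of L] by auto
    then show "c * real (card S) > 0" using c(1) S(1) by (simp add: card_gt_0_iff)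
    show "(case t of (azs, m) \<Rightarrow> \<Prod>i<n. r i azs m) > 0" if "t \<in> set_pmf L" for t
      using rpos that by (cases t) (auto intro!: prod_pos)
    \<comment> \<open>What remains of the integrand once the bound on \<open>pmf L\<close> has
      cancelled \<open>Q\<close> in the denominators of \<open>r\<close>.\<close>
    define h where "h m azs = (\<Prod>i<n. w i (fst (azs ! i)) m (map snd azs) / v m (map snd azs)
      * pmf ?Qz (snd (azs ! i)))" for m azs
    have hnn: "h m azs \<ge> 0" for m azs
      unfolding h_def w_def v_def by (intro prod_nonneg) auto
    have "measure_pmf.expectation L (\<lambda>t. case t of (azs, m) \<Rightarrow> \<Prod>i<n. r i azs m)
      = (\<Sum>(azs, m)\<in>set_pmf L. pmf L (azs, m) * (\<Prod>i<n. r i azs m))"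
      unfolding expectation_finite[OF finL] by (intro sum.cong) auto
    also have "\<dots> \<le> (\<Sum>(azs, m)\<in>set_pmf L. c * h m azs)"
    proof (rule sum_mono, clarify)
      fix azs m assume t: "(azs, m) \<in> set_pmf L"
      have "pmf L (azs, m) * (\<Prod>i<n. r i azs m) \<le> (c * (\<Prod>i<n. pmf Q (azs ! i))) * (\<Prod>i<n. r i azs m)"
        using c(2)[of azs m] rpos[OF t] pmf_replicate[OF len[OF t], of Q]
        by (intro mult_right_mono prod_nonneg) (auto intro: less_imp_le)
      also have "\<dots> = c * (\<Prod>i<n. pmf Q (azs ! i) * r i azs m)"
        by (simp add: prod.distrib)
      also have "(\<Prod>i<n. pmf Q (azs ! i) * r i azs m) = h m azs"
        unfolding h_def r_def using pQ[OF t] by (intro prod.cong) (auto simp: less_imp_neq[symmetric])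
      finally show "pmf L (azs, m) * (\<Prod>i<n. r i azs m) \<le> c * h m azs" .
    qed
    \<comment> \<open>The terms are nonnegative, so the sum may be extended from the support to all
      sequences, where distributivity applies.\<close>
    also have "\<dots> \<le> (\<Sum>(azs, m)\<in>{azs. length azs = n} \<times> S. c * h m azs)"
      using sub S(1) c(1) hnn by (intro sum_mono2) (auto intro!: mult_nonneg_nonneg)
    also have "\<dots> = c * (\<Sum>m\<in>S. \<Sum>azs | length azs = n. h m azs)"
      by (subst sum.cartesian_product[symmetric], subst sum.swap) (simp add: sum_distrib_left)
    also have "\<dots> \<le> c * (\<Sum>m\<in>S. 1)"
    proof (intro mult_left_mono sum_mono)
      fix m assume "m \<in> S"
      have "(\<Sum>azs | length azs = n. h m azs)
         = (\<Sum>zs | length zs = n. \<Sum>as | length as = n. \<Prod>i<n. w i (as ! i) m zs / v m zs * pmf ?Qz (zs ! i))"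
        unfolding sum_zip h_def by (intro sum.cong refl prod.cong) auto
      also have "\<dots> = (\<Sum>zs | length zs = n. (\<Prod>i<n. \<Sum>a\<in>UNIV. w i a m zs / v m zs) * (\<Prod>i<n. pmf ?Qz (zs ! i)))"
        by (intro sum.cong refl)
           (simp add: prod.distrib sum_distrib_right[symmetric] sum_lists_prod[symmetric] del: times_divide_eq_left)
      also have "\<dots> \<le> (\<Sum>zs | length zs = n. 1 * (\<Prod>i<n. pmf ?Qz (zs ! i)))"
        by (intro sum_mono mult_right_mono prod_le_1 prod_nonneg conjI wv sum_nonneg)
           (auto simp: w_def v_def)
      also have "\<dots> = 1"
        using sum_lists_prod[where n = n and f = "\<lambda>i. pmf ?Qz"] sum_pmf_eq_1[of UNIV ?Qz] by simp
      finally show "(\<Sum>azs | length azs = n. h m azs) \<le> 1" .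
    qed (use c(1) in simp)
    finally show "measure_pmf.expectation L (\<lambda>t. case t of (azs, m) \<Rightarrow> \<Prod>i<n. r i azs m) \<le> c * real (card S)"
      by simp
  qed
  finally show ?thesis .
qed

section \<open>Total variation distance\<close>

lemma tv_bound: "\<bar>measure_pmf.prob P A - measure_pmf.prob Q A\<bar> \<le> 1"
proof -
  have "0 \<le> measure_pmf.prob P A" "measure_pmf.prob P A \<le> 1" "0 \<le> measure_pmf.prob Q A" "measure_pmf.prob Q A \<le> 1"
    by auto
  then show ?thesis by linarith
qed

lemma tv_upper: "\<bar>measure_pmf.prob P A - measure_pmf.prob Q A\<bar> \<le> tv P Q"
  unfolding tv_def by (rule cSUP_upper) (auto intro!: bdd_aboveI2[where M = 1] tv_bound)

lemma tv_least: "(\<And>A. \<bar>measure_pmf.prob P A - measure_pmf.prob Q A\<bar> \<le> c) \<Longrightarrow> tv P Q \<le> c"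
  unfolding tv_def by (rule cSUP_least) auto

lemma tv_nonneg: "tv P Q \<ge> 0"
  using tv_upper[of P "{}" Q] by simp

lemma tv_lim_self: "tv_lim P P = 0"
  unfolding tv_lim_def by (simp add: tv_def Limsup_const zero_ereal_def)

lemma tv_lim_le_1: "tv_lim P Q \<le> 1"
  unfolding tv_lim_def one_ereal_def
  by (intro Limsup_bounded always_eventually allI) (simp add: tv_least tv_bound)

text \<open>The overlap \<open>1 - tv\<close> of product distributions is at most the Bhattacharyya coefficient, which tensorizes.\<close>

lemma overlap_replicate_le:
  fixes P Q :: "'a::finite pmf"
  shows "1 - tv (replicate_pmf n P) (replicate_pmf n Q) \<le> (\<Sum>a\<in>UNIV. sqrt (pmf P a * pmf Q a)) ^ n"
proof -
  let ?p = "pmf (replicate_pmf n P)" and ?q = "pmf (replicate_pmf n Q)"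
  let ?N = "{xs :: 'a list. length xs = n}"
  \<comment> \<open>The likelihood-ratio event: subtracting its probability gap from the total mass
    1 leaves the sum of the pointwise minima.\<close>
  define A where "A = {xs \<in> ?N. ?q xs < ?p xs}"
  have finA: "finite A" unfolding A_def by simp
  have "sum ?p ?N = 1"
    by (rule sum_pmf_eq_1) (auto simp: set_replicate_pmf)
  moreover have "measure_pmf.prob (replicate_pmf n P) A - measure_pmf.prob (replicate_pmf n Q) A
      \<le> tv (replicate_pmf n P) (replicate_pmf n Q)"
    using tv_upper[of "replicate_pmf n P" A "replicate_pmf n Q"] by simp
  moreover have "measure_pmf.prob (replicate_pmf n P) A - measure_pmf.prob (replicate_pmf n Q) A
      = (\<Sum>xs\<in>A. ?p xs - ?q xs)"
    by (simp add: measure_measure_pmf_finite[OF finA] sum_subtractf)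
  moreover have "(\<Sum>xs\<in>A. ?p xs - ?q xs) = (\<Sum>xs\<in>?N. if ?q xs < ?p xs then ?p xs - ?q xs else 0)"
    unfolding A_def by (rule sum.inter_filter) simp
  ultimately have "1 - tv (replicate_pmf n P) (replicate_pmf n Q)
     \<le> (\<Sum>xs\<in>?N. ?p xs) - (\<Sum>xs\<in>?N. if ?q xs < ?p xs then ?p xs - ?q xs else 0)"
    by linarith
  also have "\<dots> = (\<Sum>xs\<in>?N. min (?p xs) (?q xs))"
    unfolding sum_subtractf[symmetric] by (intro sum.cong) auto
  also have "\<dots> \<le> (\<Sum>xs\<in>?N. \<Prod>i<n. sqrt (pmf P (xs ! i) * pmf Q (xs ! i)))"
  proof (rule sum_mono)
    fix xs assume "xs \<in> ?N"
    then have len: "length xs = n" by simp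
    have "min (?p xs) (?q xs) \<le> sqrt (?p xs * ?q xs)"
      by (rule real_le_rsqrt) (auto simp: power2_eq_square min_def intro!: mult_mono)
    also have "?p xs * ?q xs = (\<Prod>i<n. pmf P (xs ! i) * pmf Q (xs ! i))"
      unfolding pmf_replicate[OF len] prod.distrib ..
    also have "sqrt \<dots> = (\<Prod>i<n. sqrt (pmf P (xs ! i) * pmf Q (xs ! i)))"
      by (induction n) (simp_all add: real_sqrt_mult)
    finally show "min (?p xs) (?q xs) \<le> (\<Prod>i<n. sqrt (pmf P (xs ! i) * pmf Q (xs ! i)))" .
  qed
  also have "\<dots> = (\<Sum>a\<in>UNIV. sqrt (pmf P a * pmf Q a)) ^ n"
    using sum_lists_prod[where n = n and f = "\<lambda>i a. sqrt (pmf P a * pmf Q a)"] by simp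
  finally show ?thesis .
qed

text \<open>The deficit of the coefficient from 1 is half the sum of the squared differences of
  square roots, a squared Hellinger distance. The coordinate \<open>a\<close> alone contributes
  \<open>\<delta>^2 / 4\<close> to that sum, because two square roots of probabilities add up to at
  most 2.\<close>

lemma bhattacharyya_le:
  fixes P Q :: "'a::finite pmf"
  assumes "\<delta> \<ge> 0" "\<bar>pmf P a - pmf Q a\<bar> \<ge> \<delta>"
  shows "(\<Sum>a\<in>UNIV. sqrt (pmf P a * pmf Q a)) \<le> 1 - \<delta>\<^sup>2 / 8"
proof -
  let ?d = "\<lambda>a. sqrt (pmf P a) - sqrt (pmf Q a)" and ?s = "sqrt (pmf P a) + sqrt (pmf Q a)"
  have "\<delta> \<le> \<bar>?d a * ?s\<bar>"
    using assms(2) by (simp add: algebra_simps)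
  also have "\<dots> = \<bar>?d a\<bar> * ?s"
    by (simp add: abs_mult)
  also have "\<dots> \<le> \<bar>?d a\<bar> * 2"
  proof (rule mult_left_mono)
    have "sqrt (pmf P a) \<le> 1" "sqrt (pmf Q a) \<le> 1"
      by (simp_all add: pmf_le_1)
    then show "?s \<le> 2" by linarith
  qed simp
  finally have "(\<delta> / 2)\<^sup>2 \<le> \<bar>?d a\<bar>\<^sup>2"
    using assms(1) by (intro power_mono) auto
  then have "\<delta>\<^sup>2 / 4 \<le> (?d a)\<^sup>2"
    by (simp add: power_divide)
  also have "\<dots> \<le> (\<Sum>a\<in>UNIV. (?d a)\<^sup>2)"
    by (rule member_le_sum) auto
  also have "\<dots> = (\<Sum>a\<in>UNIV. pmf P a + pmf Q a - 2 * sqrt (pmf P a * pmf Q a))"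
    by (intro sum.cong refl) (simp add: power2_diff real_sqrt_mult)
  also have "\<dots> = 2 - 2 * (\<Sum>a\<in>UNIV. sqrt (pmf P a * pmf Q a))"
    by (simp add: sum.distrib sum_subtractf sum_distrib_left sum_pmf_eq_1)
  finally show ?thesis by simp
qed

text \<open>If the laws differ by \<open>\<delta>\<close> at some letter, the overlap of the
  products decays geometrically at a rate that does not depend on \<open>Q\<close>. The uniformity
  matters because in the application \<open>Q\<close> may change with \<open>n\<close>.\<close>

lemma tv_replicate_separation:
  fixes P :: "'a::finite pmf"
  assumes "c < 1" "\<delta> > 0"
  shows "eventually (\<lambda>n. \<forall>Q. tv (replicate_pmf n P) (replicate_pmf n Q) \<le> c
            \<longrightarrow> (\<forall>a. \<bar>pmf P a - pmf Q a\<bar> < \<delta>)) sequentially"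
proof -
  \<comment> \<open>The maximum with 0 keeps the base nonnegative, so that its powers tend to 0 even
    for large \<open>\<delta>\<close>.\<close>
  define \<theta> where "\<theta> = max 0 (1 - \<delta>\<^sup>2 / 8)"
  have "(\<lambda>n. \<theta> ^ n) \<longlonglongrightarrow> 0"
    using assms(2) by (intro LIMSEQ_power_zero) (auto simp: \<theta>_def)
  then have "eventually (\<lambda>n. \<theta> ^ n < 1 - c) sequentially"
    using assms(1) by (intro order_tendstoD) auto
  then show ?thesis
  proof eventually_elim
    case (elim n)
    show ?case
    proof (intro allI impI, rule ccontr)
      fix Q a
      assume tv: "tv (replicate_pmf n P) (replicate_pmf n Q) \<le> c" and "\<not> \<bar>pmf P a - pmf Q a\<bar> < \<delta>"
      then have "(\<Sum>a\<in>UNIV. sqrt (pmf P a * pmf Q a)) \<le> \<theta>"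
        using bhattacharyya_le[of \<delta> P a Q] assms(2) by (simp add: \<theta>_def)
      then have "(\<Sum>a\<in>UNIV. sqrt (pmf P a * pmf Q a)) ^ n \<le> \<theta> ^ n"
        by (intro power_mono sum_nonneg) auto
      then show False
        using overlap_replicate_le[of n P Q] tv elim by linarith
    qed
  qed
qed

text \<open>The kernel of the maximal coupling: keep \<open>y\<close> with probability \<open>min (P y) (Q y) / Q y\<close>, otherwise
  resample from the normalized excess of \<open>P\<close> over \<open>Q\<close>.\<close>

lemma exists_coupling_kernel:
  fixes P Q :: "'a::finite pmf"
  shows "\<exists>V. bind_pmf Q V = P \<and> (\<forall>y. pmf Q y * (1 - pmf (V y) y) \<le> \<bar>pmf P y - pmf Q y\<bar>)"
proof (cases "P = Q")
  case True
  then show ?thesis by (intro exI[of _ return_pmf]) (simp add: bind_return_pmf')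
next
  case False
  define m where "m y = min (pmf P y) (pmf Q y)" for y
  define s where "s = (\<Sum>y\<in>UNIV. pmf P y - m y)"
  \<comment> \<open>Both laws have mass 1, so their excesses over the overlap \<open>m\<close> have
    the same total.\<close>
  have s': "s = (\<Sum>y\<in>UNIV. pmf Q y - m y)"
    unfolding s_def by (simp add: sum_subtractf sum_pmf_eq_1)
  have snn: "s \<ge> 0" unfolding s_def by (intro sum_nonneg) (auto simp: m_def)
  have "s \<noteq> 0"
  proof
    assume "s = 0"
    then have "\<forall>y\<in>UNIV. pmf P y - m y = 0"
      unfolding s_def by (subst sum_nonneg_eq_0_iff[symmetric]) (auto simp: m_def)
    moreover from \<open>s = 0\<close> have "\<forall>y\<in>UNIV. pmf Q y - m y = 0"
      unfolding s' by (subst sum_nonneg_eq_0_iff[symmetric]) (auto simp: m_def)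
    ultimately have "P = Q" by (intro pmf_eqI) simp
    with False show False by simp
  qed
  with snn have s: "s > 0" by simp
  define E where "E = embed_pmf (\<lambda>y. (pmf P y - m y) / s)"
  have E: "pmf E y = (pmf P y - m y) / s" for y
    unfolding E_def
  proof (rule pmf_embed_pmf)
    show "0 \<le> (pmf P x - m x) / s" for x using s by (simp add: m_def)
    have "(\<integral>\<^sup>+ x. ennreal ((pmf P x - m x) / s) \<partial>count_space UNIV)
        = ennreal (\<Sum>x\<in>UNIV. (pmf P x - m x) / s)"
      using s by (subst nn_integral_count_space_finite) (auto simp: m_def intro!: sum_ennreal)
    also have "\<dots> = 1" using s by (simp add: sum_divide_distrib[symmetric] s_def[symmetric])
    finally show "(\<integral>\<^sup>+ x. ennreal ((pmf P x - m x) / s) \<partial>count_space UNIV) = 1" .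
  qed
  \<comment> \<open>Where \<open>pmf Q y = 0\<close>, the quotient is 0 and \<open>m y = 0\<close>,
    so \<open>qb\<close> holds at every letter.\<close>
  define b where "b y = m y / pmf Q y" for y
  have b01: "0 \<le> b y" "b y \<le> 1" for y
    by (auto simp: b_def m_def min_def divide_le_eq_1 order.strict_iff_order)
  have qb: "pmf Q y * b y = m y" for y
    by (auto simp: b_def m_def)
  define V where "V y = bind_pmf (bernoulli_pmf (b y)) (\<lambda>h. if h then return_pmf y else E)" for y
  have V: "pmf (V y) x = b y * indicator {y} x + (1 - b y) * pmf E x" for x y
    unfolding V_def pmf_bind using b01[of y] by (simp add: indicator_def)
  have "pmf (bind_pmf Q V) x = pmf P x" for x
  proof -
    have "pmf (bind_pmf Q V) x = (\<Sum>y\<in>UNIV. pmf Q y * pmf (V y) x)"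
      unfolding pmf_bind by (subst integral_measure_pmf[of UNIV]) auto
    also have "\<dots> = (\<Sum>y\<in>UNIV. (pmf Q y * b y) * indicator {y} x + (pmf Q y - pmf Q y * b y) * pmf E x)"
      unfolding V by (intro sum.cong refl) (simp add: algebra_simps)
    also have "\<dots> = (\<Sum>y\<in>UNIV. m y * indicator {y} x) + s * pmf E x"
      unfolding qb s' by (simp add: sum.distrib sum_distrib_right)
    also have "(\<Sum>y\<in>UNIV. m y * indicator {y} x) = m x"
      by (subst sum.mono_neutral_right[of UNIV "{x}"]) auto
    finally show ?thesis using s by (simp add: E)
  qed
  moreover have "pmf Q y * (1 - pmf (V y) y) \<le> \<bar>pmf P y - pmf Q y\<bar>" for y
  proof -
    have "pmf (V y) y \<ge> b y" unfolding V using b01[of y] by simp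
    then have "pmf Q y * (1 - pmf (V y) y) \<le> pmf Q y * (1 - b y)"
      by (intro mult_left_mono) auto
    also have "\<dots> = pmf Q y - m y" using qb[of y] by (simp add: algebra_simps)
    finally show ?thesis by (simp add: m_def min_def split: if_splits)
  qed
  ultimately show ?thesis
    by (intro exI[of _ V] conjI pmf_eqI allI)
qed

section \<open>Auxiliary variables and output kernels\<close>

text \<open>Disintegration: \<open>W a\<close> is the conditional law of the second component. Off
  the support of the first marginal its value is arbitrary and never sampled.\<close>

lemma exists_channel: "\<exists>W. bind_pmf (map_pmf fst K) (\<lambda>a. map_pmf (Pair a) (W a)) = K"
proof -
  define W where "W a = map_pmf snd (cond_pmf K {t. a = fst t})" for a
  have ne: "set_pmf K \<inter> {t. a = fst t} \<noteq> {}" if "a \<in> set_pmf (map_pmf fst K)" for a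
    using that by auto
  have "map_pmf (Pair a) (W a) = cond_pmf K {t. a = fst t}" if "a \<in> set_pmf (map_pmf fst K)" for a
  proof -
    have "map_pmf (Pair a) (W a) = map_pmf (\<lambda>t. t) (cond_pmf K {t. a = fst t})"
      unfolding W_def map_pmf_comp using set_cond_pmf[OF ne[OF that]] by (intro map_pmf_cong) auto
    then show ?thesis by simp
  qed
  then have "bind_pmf (map_pmf fst K) (\<lambda>a. map_pmf (Pair a) (W a))
      = bind_pmf (map_pmf fst K) (\<lambda>a. cond_pmf K {t. a = fst t})"
    by (intro bind_pmf_cong) auto
  also have "\<dots> = K"
    by (rule bind_cond_pmf_cancel) (auto simp: measure_map_pmf intro!: arg_cong[where f = "measure_pmf.prob K"])
  finally show ?thesis by blast
qed

text \<open>The proof constructs joint laws, whereas \<open>region_e_gamma\<close> and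
  \<open>region_s_plus_gamma\<close> quantify over channels; this passes from one to the
  other.\<close>

lemma exists_chan_joint:
  assumes "map_pmf (\<lambda>(x, z, y). (x, z)) K = P"
  shows "\<exists>W. chan_joint P W = K"
proof -
  obtain W where W: "bind_pmf (map_pmf fst (map_pmf (\<lambda>(x, z, y). ((x, z), y)) K)) (\<lambda>a. map_pmf (Pair a) (W a))
      = map_pmf (\<lambda>(x, z, y). ((x, z), y)) K"
    using exists_channel by blast
  have P: "map_pmf fst (map_pmf (\<lambda>(x, z, y). ((x, z), y)) K) = P"
    using assms by (simp add: map_pmf_comp case_prod_unfold)
  have "chan_joint P (curry W) = map_pmf (\<lambda>((x, z), y). (x, z, y)) (bind_pmf P (\<lambda>a. map_pmf (Pair a) (W a)))"
    unfolding chan_joint_def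
    by (simp add: map_bind_pmf map_pmf_comp case_prod_unfold curry_def) (simp add: map_pmf_def)
  also have "\<dots> = K"
    using W unfolding P by (simp add: map_pmf_comp case_prod_unfold)
  finally show ?thesis by blast
qed

text \<open>The kernel sees \<open>u\<close> alone, not \<open>x\<close> or \<open>z\<close>. For a
  code this is no restriction on the decoder, as the auxiliary variable contains all of
  \<open>z^n\<close>.\<close>

definition with_output :: "('x \<times> 'u \<times> 'z) pmf \<Rightarrow> ('u \<Rightarrow> 'y pmf) \<Rightarrow> ('x \<times> 'u \<times> 'z \<times> 'y) pmf" where
  "with_output L K = bind_pmf L (\<lambda>(x, u, z). map_pmf (\<lambda>y. (x, u, z, y)) (K u))"

lemma with_output_input: "map_pmf (\<lambda>(x, u, z, y). (x, u, z)) (with_output L K) = L"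
  by (simp add: with_output_def map_bind_pmf map_pmf_comp case_prod_unfold map_pmf_const bind_return_pmf')

lemma with_output_marginal:
  "map_pmf (\<lambda>(x, u, z, y). f x u z) (with_output L K) = map_pmf (\<lambda>(x, u, z). f x u z) L"
  by (subst with_output_input[of L K, symmetric]) (simp only: map_pmf_comp case_prod_unfold fst_conv snd_conv)

lemma finite_set_with_output:
  fixes K :: "'u \<Rightarrow> 'y::finite pmf"
  shows "finite (set_pmf L) \<Longrightarrow> finite (set_pmf (with_output L K))"
  by (auto simp: with_output_def)

text \<open>The kernel recovers the original label from \<open>\<phi> u\<close> by
  \<open>inv \<phi>\<close>, so it depends on the conditioning pair alone.\<close>

lemma cond_indep_with_output:
  assumes "inj \<phi>"
  shows "cond_indep (map_pmf (\<lambda>(x, u, z, y). (x, y, (\<phi> u, z))) (with_output L K))"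
proof -
  have "map_pmf (\<lambda>(x, u, z, y). (x, y, (\<phi> u, z))) (with_output L K)
     = bind_pmf (map_pmf (\<lambda>(x, u, z). (x, (\<phi> u, z))) L) (\<lambda>(a, c). map_pmf (\<lambda>b. (a, b, c)) (K (inv \<phi> (fst c))))"
    using assms by (simp add: with_output_def map_bind_pmf bind_map_pmf map_pmf_comp case_prod_unfold)
  then show ?thesis
    using cond_indep_kernel[of "map_pmf (\<lambda>(x, u, z). (x, (\<phi> u, z))) L" "\<lambda>c. K (inv \<phi> (fst c))"]
    by simp
qed

text \<open>Data processing along the Markov chain \<open>X - (U, Z) - Y\<close>.\<close>

lemma with_output_data_processing:
  fixes K :: "'u \<Rightarrow> 'y::finite pmf"
  assumes "finite (set_pmf L)"
  shows "cmi (map_pmf (\<lambda>(x, u, z, y). (x, y, z)) (with_output L K)) \<le> cmi L"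
proof -
  have "cmi (map_pmf (\<lambda>t. (fst t, snd (snd (snd t)), fst (snd (snd t)))) (with_output L K))
      \<le> cmi (map_pmf (\<lambda>t. (fst t, fst (snd t), fst (snd (snd t)))) (with_output L K))"
    using cond_indep_with_output[OF inj_on_id, of L K]
    by (intro data_processing finite_set_with_output assms) (simp add: case_prod_unfold)
  then show ?thesis
    using with_output_input[of L K] by (simp add: case_prod_unfold)
qed

text \<open>Data processing along \<open>U - (Y, Z) - W\<close>, where \<open>W\<close> is drawn
  from \<open>V y\<close>. The symmetry of \<open>cmi\<close> brings the altered variable into
  second place.\<close>

lemma with_output_post_processing:
  fixes K :: "'u \<Rightarrow> 'y::finite pmf" and V :: "'y \<Rightarrow> 'w::finite pmf"
  assumes fin: "finite (set_pmf L)"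
  shows "cmi (map_pmf (\<lambda>(x, u, z, y). (y, u, z)) (with_output L (\<lambda>u. bind_pmf (K u) V)))
      \<le> cmi (map_pmf (\<lambda>(x, u, z, y). (y, u, z)) (with_output L K))"
proof -
  define M where "M = bind_pmf (with_output L K) (\<lambda>(x, u, z, y). map_pmf (\<lambda>w. (u, z, y, w)) (V y))"
  let ?U = "\<lambda>(u, z, y, w). u" and ?Z = "\<lambda>(u, z, y, w). z" and ?Y = "\<lambda>(u, z, y, w). y" and ?W = "\<lambda>(u, z, y, w). w"
  have finM: "finite (set_pmf M)"
    using finite_set_with_output[OF fin, of K] by (auto simp: M_def)
  have "map_pmf (\<lambda>t. (?U t, ?W t, (?Y t, ?Z t))) M
     = bind_pmf (map_pmf (\<lambda>(x, u, z, y). (u, (y, z))) (with_output L K))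
         (\<lambda>(a, c). map_pmf (\<lambda>b. (a, b, c)) (V (fst c)))"
    by (simp add: M_def map_bind_pmf bind_map_pmf map_pmf_comp case_prod_unfold)
  then have ci: "cond_indep (map_pmf (\<lambda>t. (?U t, ?W t, (?Y t, ?Z t))) M)"
    using cond_indep_kernel[of "map_pmf (\<lambda>(x, u, z, y). (u, (y, z))) (with_output L K)" "\<lambda>c. V (fst c)"]
    by simp
  have 1: "map_pmf (\<lambda>(x, u, z, y). (y, u, z)) (with_output L (\<lambda>u. bind_pmf (K u) V)) = map_pmf (\<lambda>t. (?W t, ?U t, ?Z t)) M"
    by (simp add: M_def with_output_def map_bind_pmf bind_map_pmf map_pmf_comp bind_assoc_pmf case_prod_unfold)
  have 2: "map_pmf (\<lambda>(x, u, z, y). (y, u, z)) (with_output L K) = map_pmf (\<lambda>t. (?Y t, ?U t, ?Z t)) M"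
    by (simp add: M_def map_bind_pmf map_pmf_comp case_prod_unfold map_pmf_const) (simp add: map_pmf_def case_prod_unfold)
  show ?thesis
    unfolding 1 2 cmi_map_commute[OF finM, of ?W] cmi_map_commute[OF finM, of ?Y]
    by (rule data_processing[OF finM ci])
qed

text \<open>A letter \<open>y\<close> is moved with probability \<open>1 - pmf (V y) y\<close>, and
  a move costs at most \<open>dmax\<close>. The moved mass is at most \<open>\<delta>\<close> for
  each letter of the alphabet.\<close>

lemma with_output_post_processing_cost:
  fixes K :: "'u \<Rightarrow> 'x::finite pmf" and V :: "'x \<Rightarrow> 'x pmf" and D :: "'x \<Rightarrow> 'x \<Rightarrow> real"
  assumes fin: "finite (set_pmf L)" and D: "\<And>a b. 0 \<le> D a b" "\<And>a b. D a b \<le> dmax"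
    and V: "\<And>y. pmf (map_pmf (\<lambda>(x, u, z, y). y) (with_output L K)) y * (1 - pmf (V y) y) \<le> \<delta>"
  shows "measure_pmf.expectation (with_output L (\<lambda>u. bind_pmf (K u) V)) (\<lambda>(x, u, z, y). D x y)
      \<le> measure_pmf.expectation (with_output L K) (\<lambda>(x, u, z, y). D x y) + dmax * (real CARD('x) * \<delta>)"
proof -
  let ?J = "with_output L K" and ?Y = "map_pmf (\<lambda>(x, u, z, y). y) (with_output L K)"
  have finJ: "finite (set_pmf ?J)" by (rule finite_set_with_output[OF fin])
  note [simp] = integrable_measure_pmf_finite[OF finJ]
  have dmax: "dmax \<ge> 0" using D order_trans by blast
  have J': "with_output L (\<lambda>u. bind_pmf (K u) V) = bind_pmf ?J (\<lambda>(x, u, z, y). map_pmf (\<lambda>w. (x, u, z, w)) (V y))"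
    by (simp add: with_output_def map_bind_pmf bind_map_pmf bind_assoc_pmf case_prod_unfold)
  have "measure_pmf.expectation (with_output L (\<lambda>u. bind_pmf (K u) V)) (\<lambda>(x, u, z, y). D x y)
      = measure_pmf.expectation ?J (\<lambda>(x, u, z, y). measure_pmf.expectation (V y) (\<lambda>w. D x w))"
    unfolding J'
    by (subst pmf_expectation_bind[of "set_pmf ?J"])
       (auto simp: finJ expectation_finite[OF finJ] intro!: sum.cong)
  also have "\<dots> \<le> measure_pmf.expectation ?J (\<lambda>(x, u, z, y). D x y + dmax * (1 - pmf (V y) y))"
  proof (rule expectation_mono_pmf[OF finJ], clarify)
    fix x y
    have "measure_pmf.expectation (V y) (\<lambda>w. D x w) \<le> measure_pmf.expectation (V y) (\<lambda>w. D x y + dmax * (1 - indicator {y} w))"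
      using D dmax by (intro expectation_mono_pmf) (auto simp: indicator_def add_increasing)
    also have "\<dots> = D x y + dmax * (1 - pmf (V y) y)"
      by (simp add: integrable_measure_pmf_finite measure_pmf_single)
    finally show "measure_pmf.expectation (V y) (\<lambda>w. D x w) \<le> D x y + dmax * (1 - pmf (V y) y)" .
  qed
  also have "\<dots> = measure_pmf.expectation ?J (\<lambda>(x, u, z, y). D x y)
      + dmax * measure_pmf.expectation ?J (\<lambda>(x, u, z, y). 1 - pmf (V y) y)"
    by (simp add: case_prod_unfold)
  also have "measure_pmf.expectation ?J (\<lambda>(x, u, z, y). 1 - pmf (V y) y)
      = measure_pmf.expectation ?Y (\<lambda>y. 1 - pmf (V y) y)"
    by (simp add: case_prod_unfold)
  also have "\<dots> = (\<Sum>y\<in>UNIV. pmf ?Y y * (1 - pmf (V y) y))"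
    by (subst integral_measure_pmf[of UNIV]) auto
  also have "\<dots> \<le> (\<Sum>y\<in>(UNIV :: 'x set). \<delta>)"
    by (intro sum_mono V)
  finally show ?thesis
    using dmax by (simp add: mult_left_mono)
qed

text \<open>No information on \<open>f(\<Delta>)\<close> is needed: if \<open>\<Pi> \<ge> f(\<Delta>)\<close>, the same joint distribution gives a point of the
  plus region, since \<open>I(X;Y|Z) \<le> I(X;U|Z)\<close>.\<close>

lemma region_s_intro:
  fixes P :: "('x::finite \<times> 'z) pmf" and L :: "('x \<times> 'u::countable \<times> 'z) pmf" and K :: "'u \<Rightarrow> 'x pmf"
  defines "J \<equiv> with_output L K"
  assumes fin: "finite (set_pmf L)" and \<gamma>: "\<gamma> > 0" and R0: "R0 > 0"
    and marg: "map_pmf (\<lambda>(x, u, z). (x, z)) L = P"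
    and R: "R \<ge> cmi L + \<gamma>"
    and RR0: "R + R0 \<ge> cmi (map_pmf (\<lambda>(x, u, z, y). (y, u, z)) J) + \<gamma>"
    and \<Delta>: "\<Delta> \<ge> measure_pmf.expectation J (\<lambda>(x, u, z, y). D x y)"
    and Pm: "ereal Pm \<ge> tv_lim (map_pmf fst P) (map_pmf (\<lambda>(x, u, z, y). y) J)"
  shows "(R, R0, \<Delta>, Pm) \<in> region_s P D"
proof (cases "ereal Pm < ffun P D \<Delta>")
  case True
  let ?\<phi> = "to_nat :: 'u \<Rightarrow> nat"
  define N where "N = map_pmf (\<lambda>(x, u, z, y). (x, z, ?\<phi> u, y)) J"
  have finJ: "finite (set_pmf J)"
    unfolding J_def by (rule finite_set_with_output[OF fin])
  have xz: "map_pmf (\<lambda>(x, u, z, y). (x, z)) J = P"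
    unfolding J_def with_output_marginal[of "\<lambda>x u z. (x, z)"] marg ..
  have "finite (set_pmf N)"
    using finJ by (simp add: N_def)
  moreover have "map_pmf (\<lambda>(x, z, u, y). (x, z)) N = P"
    using xz by (simp add: N_def map_pmf_comp case_prod_unfold)
  moreover have "cond_indep (map_pmf (\<lambda>(x, z, u, y). (x, y, (u, z))) N)"
    using cond_indep_with_output[OF inj_to_nat, of L K] by (simp add: N_def J_def map_pmf_comp case_prod_unfold)
  moreover have "cmi (map_pmf (\<lambda>(x, z, u, y). (x, u, z)) N) = cmi L"
    using cmi_map_inj[OF finJ inj_to_nat, of fst "\<lambda>t. fst (snd t)" "\<lambda>t. fst (snd (snd t))"]
      with_output_input[of L K]
    by (simp add: N_def J_def map_pmf_comp case_prod_unfold)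
  moreover have "cmi (map_pmf (\<lambda>(x, z, u, y). (y, u, z)) N) = cmi (map_pmf (\<lambda>(x, u, z, y). (y, u, z)) J)"
    using cmi_map_inj[OF finJ inj_to_nat, of "\<lambda>t. snd (snd (snd t))" "\<lambda>t. fst (snd t)" "\<lambda>t. fst (snd (snd t))"]
    by (simp add: N_def map_pmf_comp case_prod_unfold)
  moreover have "measure_pmf.expectation N (\<lambda>(x, z, u, y). D x y) = measure_pmf.expectation J (\<lambda>(x, u, z, y). D x y)"
    by (simp add: N_def case_prod_unfold)
  moreover have "map_pmf (\<lambda>(x, z, u, y). x) N = map_pmf fst P"
    unfolding xz[symmetric] by (simp add: N_def map_pmf_comp case_prod_unfold)
  moreover have "map_pmf (\<lambda>(x, z, u, y). y) N = map_pmf (\<lambda>(x, u, z, y). y) J"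
    by (simp add: N_def map_pmf_comp case_prod_unfold)
  ultimately have "(R, R0, \<Delta>, Pm) \<in> region_s_minus_gamma P D \<gamma>"
    unfolding region_s_minus_gamma_def using R0 R RR0 \<Delta> Pm True
    by (auto intro!: exI[of _ N])
  then show ?thesis using \<gamma> by (auto simp: region_s_def)
next
  case False
  define M where "M = map_pmf (\<lambda>(x, u, z, y). (x, z, y)) J"
  have "map_pmf (\<lambda>(x, z, y). (x, z)) M = P"
    unfolding M_def using with_output_marginal[of "\<lambda>x u z. (x, z)" L K] marg
    by (simp add: J_def map_pmf_comp case_prod_unfold)
  then obtain W where W: "chan_joint P W = M" using exists_chan_joint by blast
  have "I_XY_Z M \<le> cmi L"
    using with_output_data_processing[OF fin, of K] by (simp add: I_XY_Z_def M_def J_def map_pmf_comp case_prod_unfold)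
  moreover have "ED D M \<le> \<Delta>"
    using \<Delta> by (simp add: ED_def M_def case_prod_unfold)
  ultimately have "(R, R0, \<Delta>, Pm) \<in> region_s_plus_gamma P D \<gamma>"
    unfolding region_s_plus_gamma_def using False R0 R W by (auto intro!: exI[of _ W])
  then show ?thesis using \<gamma> by (auto simp: region_s_def)
qed

section \<open>Codes\<close>

text \<open>The source is drawn first and kept as the left component, so that
  \<open>pmf_bind_Pair\<close> gives each atom as source mass times conditional mass of
  \<open>(m, k)\<close>.\<close>

definition code_msg ::
  "('x \<times> 'z) pmf \<Rightarrow> nat \<Rightarrow> real \<Rightarrow> ('x list \<Rightarrow> 'z list \<Rightarrow> nat \<Rightarrow> nat pmf)
     \<Rightarrow> (('x \<times> 'z) list \<times> nat \<times> nat) pmf" where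
  "code_msg P n R0 e = bind_pmf (replicate_pmf n P) (\<lambda>xzs. map_pmf (Pair xzs)
     (bind_pmf (pmf_of_set (idx n R0)) (\<lambda>k. map_pmf (\<lambda>m. (m, k)) (e (map fst xzs) (map snd xzs) k))))"

text \<open>Unlike \<open>code_joint\<close>, this retains the message and the common randomness,
  which enter the auxiliary variable.\<close>

definition code_full ::
  "('x \<times> 'z) pmf \<Rightarrow> nat \<Rightarrow> real \<Rightarrow> ('x list \<Rightarrow> 'z list \<Rightarrow> nat \<Rightarrow> nat pmf)
     \<Rightarrow> (nat \<Rightarrow> 'z list \<Rightarrow> nat \<Rightarrow> 'x list pmf) \<Rightarrow> (('x \<times> 'z) list \<times> (nat \<times> nat) \<times> 'x list) pmf" where
  "code_full P n R0 e d = bind_pmf (code_msg P n R0 e)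
     (\<lambda>(xzs, m, k). map_pmf (\<lambda>ys. (xzs, (m, k), ys)) (d m (map snd xzs) k))"

text \<open>The decoder observed at time \<open>i\<close>, as a function of the auxiliary variable
  alone.\<close>

definition letter_kernel :: "(nat \<Rightarrow> 'z list \<Rightarrow> nat \<Rightarrow> 'x list pmf)
     \<Rightarrow> (nat \<times> nat) \<times> 'z list \<times> nat \<Rightarrow> 'x pmf" where
  "letter_kernel d = (\<lambda>((m, k), zs, i). map_pmf (\<lambda>ys. ys ! i) (d m zs k))"

lemma code_joint_eq:
  "code_joint P n R0 e d = map_pmf (\<lambda>(xzs, mk, ys). (map fst xzs, map snd xzs, ys)) (code_full P n R0 e d)"
  unfolding code_joint_def code_full_def code_msg_def
  by (simp add: map_bind_pmf bind_map_pmf map_pmf_comp bind_assoc_pmf case_prod_unfold)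
     (simp add: map_pmf_def)

lemma code_msg_source: "map_pmf fst (code_msg P n R0 e) = replicate_pmf n P"
  by (simp add: code_msg_def map_bind_pmf map_pmf_comp map_pmf_const bind_return_pmf')

lemma code_full_msg: "map_pmf (\<lambda>(xzs, mk, ys). (xzs, mk)) (code_full P n R0 e d) = code_msg P n R0 e"
  by (simp add: code_full_def map_bind_pmf map_pmf_comp map_pmf_const bind_return_pmf' case_prod_unfold)

text \<open>Given \<open>(m, k, z^n)\<close> the decoder ignores the source. Sampling the output
  letter afresh from its law given \<open>U\<close> therefore yields the same joint law as reading
  letter \<open>i\<close> of the actual output.\<close>

lemma with_output_single_letter:
  "with_output (single_letter n (code_msg P n R0 e)) (letter_kernel d)
   = map_pmf (\<lambda>((xzs, mk, ys), i). (fst (xzs ! i), (mk, map snd xzs, i), snd (xzs ! i), ys ! i))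
       (pair_pmf (code_full P n R0 e d) (pmf_of_set {..<n}))"
  unfolding with_output_def single_letter_def bind_map_pmf pair_pmf_bind code_full_def letter_kernel_def
  unfolding pair_pmf_def
  by (simp add: map_bind_pmf bind_map_pmf map_pmf_comp bind_assoc_pmf bind_return_pmf case_prod_unfold)

section \<open>Atoms, empirical laws and index sets\<close>

lemma pmf_le_pmf_map: "pmf M t \<le> pmf (map_pmf f M) (f t)"
  using measure_pmf.finite_measure_mono[of "{t}" "f -` {f t}" M] by (simp add: measure_pmf_single pmf_map)

lemma pmf_bind_Pair: "pmf (bind_pmf M (\<lambda>a. map_pmf (Pair a) (N a))) (a, b) = pmf M a * pmf (N a) b"
proof -
  have "pmf (map_pmf (Pair a') (N a')) (a, b) = pmf (N a) b * indicator {a} a'" for a'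
    by (cases "a' = a") (auto simp: pmf_map_inj' inj_on_def pmf_eq_0_set_pmf)
  then show ?thesis
    unfolding pmf_bind by (simp add: measure_pmf_single)
qed

lemma prob_emp:
  assumes "xs \<noteq> []"
  shows "measure_pmf.prob (emp xs) A = (\<Sum>i<length xs. indicator A (xs ! i)) / length xs"
proof -
  have ne: "{..<length xs} \<noteq> {}" using assms by auto
  have "measure_pmf.prob (emp xs) A = measure_pmf.expectation (emp xs) (indicator A)"
    by simp
  also have "\<dots> = (\<Sum>i<length xs. indicator A (xs ! i)) / length xs"
    unfolding emp_def integral_map_pmf using ne by (subst integral_pmf_of_set) auto
  finally show ?thesis .
qed

lemma finite_idx: "finite (idx n R)"
  by (simp add: idx_def)

lemma log_card_idx_le:
  assumes "idx n R \<noteq> {}"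
  shows "log 2 (real (card (idx n R))) \<le> real n * R"
proof -
  have pos: "card (idx n R) > 0"
    using assms finite_idx by (simp add: card_gt_0_iff)
  have "real (card (idx n R)) \<le> 2 powr (real n * R)"
    by (simp add: idx_def)
  then have "log 2 (real (card (idx n R))) \<le> log 2 (2 powr (real n * R))"
    using pos by (subst log_le_cancel_iff) auto
  then show ?thesis by simp
qed

text \<open>A set with at least one element has nonnegative log-cardinality. This yields the sign
  condition on \<open>R0\<close> in the regions.\<close>

lemma idx_nonempty_imp_nonneg:
  assumes "idx n R \<noteq> {}" "n > 0"
  shows "R \<ge> 0"
proof -
  have "card (idx n R) > 0"
    using assms(1) finite_idx by (simp add: card_gt_0_iff)
  then have "0 \<le> log 2 (real (card (idx n R)))"
    by simp
  then have "0 \<le> real n * R"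
    using log_card_idx_le[OF assms(1)] by linarith
  then show ?thesis
    using assms(2) by (simp add: zero_le_mult_iff)
qed

section \<open>Information and distortion bounds for one code of positive length\<close>

context
  fixes P :: "('x::finite \<times> 'z::finite) pmf" and n :: nat and R R0 :: real
    and e :: "'x list \<Rightarrow> 'z list \<Rightarrow> nat \<Rightarrow> nat pmf" and d :: "nat \<Rightarrow> 'z list \<Rightarrow> nat \<Rightarrow> 'x list pmf"
  assumes code: "is_code n R R0 e d" and n: "n > 0"
begin

lemma code_msg_support:
  assumes "(xzs, m, k) \<in> set_pmf (code_msg P n R0 e)"
  shows "length xzs = n" "m \<in> idx n R" "k \<in> idx n R0"
proof -
  have xzs: "xzs \<in> set_pmf (replicate_pmf n P)"
    and k: "k \<in> set_pmf (pmf_of_set (idx n R0))"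
    and m: "m \<in> set_pmf (e (map fst xzs) (map snd xzs) k)"
    using assms by (auto simp: code_msg_def)
  show len: "length xzs = n" using xzs by (rule set_replicate_pmf_length)
  show k': "k \<in> idx n R0" using k code finite_idx by (simp add: is_code_def)
  show "m \<in> idx n R" using m code len k' unfolding is_code_def by (metis length_map subsetD)
qed

lemma code_full_support:
  assumes "(xzs, (m, k), ys) \<in> set_pmf (code_full P n R0 e d)"
  shows "length xzs = n" "m \<in> idx n R" "k \<in> idx n R0" "length ys = n"
proof -
  have msg: "(xzs, m, k) \<in> set_pmf (code_msg P n R0 e)"
    and ys: "ys \<in> set_pmf (d m (map snd xzs) k)"
    using assms by (auto simp: code_full_def)
  show *: "length xzs = n" "m \<in> idx n R" "k \<in> idx n R0"
    using code_msg_support[OF msg] by auto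
  show "length ys = n"
    using ys code * unfolding is_code_def by (metis (mono_tags, lifting) length_map mem_Collect_eq subsetD)
qed

lemma finite_code_full: "finite (set_pmf (code_full P n R0 e d))"
proof (rule finite_subset)
  show "set_pmf (code_full P n R0 e d) \<subseteq> {xzs. length xzs = n} \<times> (idx n R \<times> idx n R0) \<times> {ys. length ys = n}"
    using code_full_support by auto
qed (simp add: finite_idx)

lemma finite_code_msg: "finite (set_pmf (code_msg P n R0 e))"
  unfolding code_full_msg[of P n R0 e d, symmetric] using finite_code_full by simp

lemma finite_code_joint: "finite (set_pmf (code_joint P n R0 e d))"
  unfolding code_joint_eq using finite_code_full by simp

lemma finite_single_letter: "finite (set_pmf (single_letter n (code_msg P n R0 e)))"
proof -
  have "{..<n} \<noteq> {}" using n by auto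
  then show ?thesis unfolding single_letter_def using finite_code_msg by simp
qed

lemma idx_nonempty: "idx n R \<noteq> {}" "idx n R0 \<noteq> {}"
proof -
  obtain xzs m k where "(xzs, m, k) \<in> set_pmf (code_msg P n R0 e)"
    using set_pmf_not_empty[of "code_msg P n R0 e"] by auto
  then show "idx n R \<noteq> {}" "idx n R0 \<noteq> {}" using code_msg_support by blast+
qed

text \<open>The common randomness is uniform and independent of the source, so each atom of
  \<open>code_msg\<close> is at most \<open>1 / card ?K\<close> times its source mass. This factor
  cancels \<open>card ?K\<close> in the number of pairs \<open>(m, k)\<close>, and only the message
  rate is left.\<close>

lemma code_cmi_source_le: "cmi (single_letter n (code_msg P n R0 e)) \<le> R"
proof -
  let ?M = "idx n R" and ?K = "idx n R0"
  have cardK: "card ?K > 0"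
    using idx_nonempty(2) finite_idx by (simp add: card_gt_0_iff)
  have "real n * cmi (single_letter n (code_msg P n R0 e)) \<le> log 2 (1 / card ?K * real (card (?M \<times> ?K)))"
  proof (rule single_letter_cmi_le[OF n code_msg_source])
    show "finite (?M \<times> ?K)" by (simp add: finite_idx)
    show "snd ` set_pmf (code_msg P n R0 e) \<subseteq> ?M \<times> ?K"
      using code_msg_support by fastforce
    show "1 / real (card ?K) > 0" using cardK by simp
    fix xzs :: "('x \<times> 'z) list" and mk :: "nat \<times> nat"
    let ?N = "bind_pmf (pmf_of_set ?K) (\<lambda>k. map_pmf (\<lambda>m. (m, k)) (e (map fst xzs) (map snd xzs) k))"
    have "map_pmf snd ?N = pmf_of_set ?K"
      by (simp add: map_bind_pmf map_pmf_comp map_pmf_const bind_return_pmf')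
    then have "pmf ?N mk \<le> pmf (pmf_of_set ?K) (snd mk)"
      using pmf_le_pmf_map[of ?N mk snd] by simp
    also have "\<dots> \<le> 1 / card ?K"
      using idx_nonempty(2) finite_idx by (simp add: indicator_def)
    finally have "pmf (replicate_pmf n P) xzs * pmf ?N mk \<le> pmf (replicate_pmf n P) xzs * (1 / card ?K)"
      by (intro mult_left_mono) auto
    then show "pmf (code_msg P n R0 e) (xzs, mk) \<le> 1 / card ?K * pmf (replicate_pmf n P) xzs"
      using pmf_bind_Pair[of "replicate_pmf n P" _ xzs mk] unfolding code_msg_def by (simp add: mult.commute)
  qed
  also have "1 / card ?K * real (card (?M \<times> ?K)) = card ?M"
    using cardK by (simp add: card_cartesian_product)
  also have "log 2 (card ?M) \<le> real n * R"
    by (rule log_card_idx_le[OF idx_nonempty(1)])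
  finally show ?thesis using n by simp
qed

context
  fixes Q :: "('x \<times> 'z) pmf"
  assumes iid: "map_pmf (\<lambda>(xs, zs, ys). zip ys zs) (code_joint P n R0 e d) = replicate_pmf n Q"
begin

text \<open>The pair \<open>(Y, Z)\<close> takes the place of the source: by the i.i.d. hypothesis
  \<open>L\<close> meets the marginal assumption of \<open>single_letter_cmi_le\<close>.\<close>

lemma code_output_single_letter:
  defines "L \<equiv> map_pmf (\<lambda>(xzs, mk, ys). (zip ys (map snd xzs), mk)) (code_full P n R0 e d)"
  shows "map_pmf fst L = replicate_pmf n Q"
    and "map_pmf (\<lambda>(x, u, z, y). (y, u, z)) (with_output (single_letter n (code_msg P n R0 e)) (letter_kernel d))
      = single_letter n L"
proof -
  have ne: "{..<n} \<noteq> {}" using n by auto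
  show "map_pmf fst L = replicate_pmf n Q"
    unfolding iid[symmetric] L_def code_joint_eq by (simp add: map_pmf_comp case_prod_unfold)
  show "map_pmf (\<lambda>(x, u, z, y). (y, u, z)) (with_output (single_letter n (code_msg P n R0 e)) (letter_kernel d))
      = single_letter n L"
    unfolding with_output_single_letter unfolding single_letter_def L_def pair_map_pmf1 map_pmf_comp
    using ne code_full_support by (intro map_pmf_cong refl) auto
qed

lemma code_output_marginal:
  "map_pmf (\<lambda>(x, u, z, y). (y, z)) (with_output (single_letter n (code_msg P n R0 e)) (letter_kernel d)) = Q"
proof -
  have "map_pmf (\<lambda>(x, u, z, y). (y, z)) (with_output (single_letter n (code_msg P n R0 e)) (letter_kernel d))
    = map_pmf (\<lambda>(a, u, z). (a, z)) (map_pmf (\<lambda>(x, u, z, y). (y, u, z))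
        (with_output (single_letter n (code_msg P n R0 e)) (letter_kernel d)))"
    by (simp add: map_pmf_comp case_prod_unfold)
  then show ?thesis
    unfolding code_output_single_letter(2)
    using single_letter_marginal[OF n code_output_single_letter(1)] by simp
qed

text \<open>The output may depend on the common randomness, so an atom is bounded merely by its
  marginal, with constant 1, and all pairs \<open>(m, k)\<close> count. Hence the sum of both
  rates.\<close>

lemma code_cmi_output_le:
  "cmi (map_pmf (\<lambda>(x, u, z, y). (y, u, z)) (with_output (single_letter n (code_msg P n R0 e)) (letter_kernel d)))
    \<le> R + R0"
proof -
  let ?M = "idx n R" and ?K = "idx n R0"
  let ?L = "map_pmf (\<lambda>(xzs, mk, ys). (zip ys (map snd xzs), mk)) (code_full P n R0 e d)"
  have card: "card ?M > 0" "card ?K > 0"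
    using idx_nonempty finite_idx by (simp_all add: card_gt_0_iff)
  have "real n * cmi (single_letter n ?L) \<le> log 2 (1 * real (card (?M \<times> ?K)))"
  proof (rule single_letter_cmi_le[OF n code_output_single_letter(1)])
    show "finite (?M \<times> ?K)" by (simp add: finite_idx)
    show "snd ` set_pmf ?L \<subseteq> ?M \<times> ?K"
      using code_full_support by fastforce
    show "pmf ?L (azs, m) \<le> 1 * pmf (replicate_pmf n Q) azs" for azs m
      using pmf_le_pmf_map[of ?L "(azs, m)" fst] unfolding code_output_single_letter(1) by simp
  qed simp
  also have "\<dots> = log 2 (card ?M) + log 2 (card ?K)"
    using card by (simp add: card_cartesian_product log_mult)
  also have "\<dots> \<le> real n * (R + R0)"
    using log_card_idx_le[OF idx_nonempty(1)] log_card_idx_le[OF idx_nonempty(2)] by (simp add: distrib_left)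
  finally show ?thesis
    unfolding code_output_single_letter(2) using n by simp
qed

lemma code_output_product:
  "map_pmf (\<lambda>(xs, zs, ys). ys) (code_joint P n R0 e d) = replicate_pmf n (map_pmf fst Q)"
proof -
  have "replicate_pmf n (map_pmf fst Q) = map_pmf (map fst) (map_pmf (\<lambda>(xs, zs, ys). zip ys zs) (code_joint P n R0 e d))"
    unfolding iid map_replicate_pmf ..
  also have "\<dots> = map_pmf (\<lambda>(xs, zs, ys). ys) (code_joint P n R0 e d)"
    unfolding code_joint_eq map_pmf_comp using code_full_support by (intro map_pmf_cong refl) auto
  finally show ?thesis by simp
qed

end

lemma code_source_product:
  "map_pmf (\<lambda>(xs, zs, ys). xs) (code_joint P n R0 e d) = replicate_pmf n (map_pmf fst P)"
proof -
  have "map_pmf (\<lambda>(xs, zs, ys). xs) (code_joint P n R0 e d)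
      = map_pmf (map fst) (map_pmf fst (map_pmf (\<lambda>(xzs, mk, ys). (xzs, mk)) (code_full P n R0 e d)))"
    unfolding code_joint_eq by (simp add: map_pmf_comp case_prod_unfold)
  then show ?thesis
    unfolding code_full_msg code_msg_source map_replicate_pmf .
qed

text \<open>A general \<open>f\<close> covers both the distortion and the differences of indicators
  that measure the perception gap.\<close>

lemma code_expectation:
  fixes f :: "'x \<Rightarrow> 'x \<Rightarrow> real"
  shows "measure_pmf.expectation (with_output (single_letter n (code_msg P n R0 e)) (letter_kernel d)) (\<lambda>(x, u, z, y). f x y)
    = measure_pmf.expectation (code_joint P n R0 e d) (\<lambda>(xs, zs, ys). avg_dist f xs ys)"
proof -
  have "measure_pmf.expectation (with_output (single_letter n (code_msg P n R0 e)) (letter_kernel d)) (\<lambda>(x, u, z, y). f x y)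
    = measure_pmf.expectation (code_full P n R0 e d) (\<lambda>(xzs, mk, ys). (\<Sum>i<n. f (fst (xzs ! i)) (ys ! i)) / n)"
    unfolding with_output_single_letter integral_map_pmf
    by (subst expectation_pair_uniform[OF finite_code_full n]) (simp add: case_prod_unfold)
  also have "\<dots> = measure_pmf.expectation (code_full P n R0 e d) (\<lambda>(xzs, mk, ys). avg_dist f (map fst xzs) ys)"
    using code_full_support by (intro expectation_cong_pmf) (auto simp: avg_dist_def)
  finally show ?thesis
    unfolding code_joint_eq by (simp add: case_prod_unfold)
qed

text \<open>For each event the gap between the single-letter laws is the mean gap between the
  empirical laws; absolute value and supremum are then taken inside the expectation.\<close>

lemma code_tv_le:
  "tv (map_pmf fst P) (map_pmf (\<lambda>(x, u, z, y). y) (with_output (single_letter n (code_msg P n R0 e)) (letter_kernel d)))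
   \<le> measure_pmf.expectation (code_joint P n R0 e d) (\<lambda>(xs, zs, ys). tv (emp xs) (emp ys))"
proof (rule tv_least)
  fix A
  let ?J = "with_output (single_letter n (code_msg P n R0 e)) (letter_kernel d)"
  let ?C = "code_joint P n R0 e d"
  have finJ: "finite (set_pmf ?J)"
    by (rule finite_set_with_output[OF finite_single_letter])
  have "map_pmf fst P = map_pmf (\<lambda>(x, u, z, y). x) ?J"
    unfolding with_output_marginal[of "\<lambda>x u z. x"]
    using arg_cong[OF single_letter_marginal[OF n code_msg_source[of P n R0 e]], of "map_pmf fst"]
    by (simp add: map_pmf_comp case_prod_unfold)
  moreover have prob: "measure_pmf.prob (map_pmf f ?J) A = measure_pmf.expectation ?J (\<lambda>t. indicator A (f t))"
    for f :: "_ \<Rightarrow> 'x"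
    by (subst integral_map_pmf[symmetric]) simp
  ultimately have "measure_pmf.prob (map_pmf fst P) A - measure_pmf.prob (map_pmf (\<lambda>(x, u, z, y). y) ?J) A
     = measure_pmf.expectation ?J (\<lambda>(x, u, z, y). indicator A x) - measure_pmf.expectation ?J (\<lambda>(x, u, z, y). indicator A y)"
    by (simp only: prob case_prod_unfold)
  also have "\<dots> = measure_pmf.expectation ?J (\<lambda>(x, u, z, y). indicator A x - indicator A y)"
    by (subst Bochner_Integration.integral_diff[symmetric])
       (auto simp: integrable_measure_pmf_finite[OF finJ] case_prod_unfold)
  also have "\<dots> = measure_pmf.expectation ?C (\<lambda>(xs, zs, ys). avg_dist (\<lambda>x y. indicator A x - indicator A y) xs ys)"
    by (rule code_expectation)
  also have "\<bar>\<dots>\<bar> \<le> measure_pmf.expectation ?C (\<lambda>t. \<bar>case t of (xs, zs, ys) \<Rightarrow> avg_dist (\<lambda>x y. indicator A x - indicator A y) xs ys\<bar>)"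
    by (rule integral_abs_bound)
  also have "\<dots> \<le> measure_pmf.expectation ?C (\<lambda>(xs, zs, ys). tv (emp xs) (emp ys))"
  proof (rule expectation_mono_pmf[OF finite_code_joint], clarify)
    fix xs zs ys assume "(xs, zs, ys) \<in> set_pmf ?C"
    then have len: "length xs = n" "length ys = n"
      using code_full_support by (auto simp: code_joint_eq)
    have "avg_dist (\<lambda>x y. indicator A x - indicator A y) xs ys = measure_pmf.prob (emp xs) A - measure_pmf.prob (emp ys) A"
      using prob_emp[of xs A] prob_emp[of ys A] len n
      by (cases "xs = [] \<or> ys = []") (auto simp: avg_dist_def sum_subtractf diff_divide_distrib)
    then show "\<bar>avg_dist (\<lambda>x y. indicator A x - indicator A y) xs ys\<bar> \<le> tv (emp xs) (emp ys)"
      using tv_upper by simp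
  qed
  finally show "\<bar>measure_pmf.prob (map_pmf fst P) A - measure_pmf.prob (map_pmf (\<lambda>(x, u, z, y). y) ?J) A\<bar>
     \<le> measure_pmf.expectation ?C (\<lambda>(xs, zs, ys). tv (emp xs) (emp ys))" .
qed

end

section \<open>The converse\<close>

text \<open>The product metric is at most the sum of the coordinate distances; four times
  \<open>r / 5\<close> stays strictly below \<open>r\<close>.\<close>

lemma closure_quadrupleI:
  fixes S :: "(real \<times> real \<times> real \<times> real) set"
  assumes "\<And>\<eta>. \<eta> > 0 \<Longrightarrow> \<exists>a' b' c' d'. (a', b', c', d') \<in> S
     \<and> \<bar>a' - a\<bar> \<le> \<eta> \<and> \<bar>b' - b\<bar> \<le> \<eta> \<and> \<bar>c' - c\<bar> \<le> \<eta> \<and> \<bar>d' - d\<bar> \<le> \<eta>"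
  shows "(a, b, c, d) \<in> closure S"
  unfolding closure_approachable
proof (intro allI impI)
  fix r :: real assume "r > 0"
  then obtain a' b' c' d' where S: "(a', b', c', d') \<in> S"
    and le: "\<bar>a' - a\<bar> \<le> r / 5" "\<bar>b' - b\<bar> \<le> r / 5" "\<bar>c' - c\<bar> \<le> r / 5" "\<bar>d' - d\<bar> \<le> r / 5"
    using assms[of "r / 5"] by auto
  have pair: "dist (u, v) (u', v') \<le> dist u u' + dist v v'" for u u' :: real and v v' :: "'k::metric_space"
    unfolding dist_Pair_Pair by (rule sqrt_sum_squares_le_sum) auto
  have "dist (a', b', c', d') (a, b, c, d) \<le> dist a' a + (dist b' b + (dist c' c + dist d' d))"
    by (intro order_trans[OF pair] add_left_mono order_refl)
  also have "\<dots> < r"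
    using le \<open>r > 0\<close> by (simp add: dist_real_def)
  finally show "\<exists>y\<in>S. dist y (a, b, c, d) < r" using S by blast
qed

text \<open>For each tolerance a single block length suffices, since the information bounds hold at
  every positive \<open>n\<close> and not only in the limit.\<close>

lemma achievable_emp_converse:
  fixes P :: "('x::finite \<times> 'z::finite) pmf"
  assumes "achievable_emp P D R R0 \<Delta> Pm"
  shows "(R, R0, \<Delta>, Pm) \<in> closure (region_e P D)"
proof (rule closure_quadrupleI)
  fix \<eta> :: real assume \<eta>: "\<eta> > 0"
  \<comment> \<open>The rate moves by \<open>2 * \<epsilon>\<close>: once for the slack of the code
    and once for the gap \<open>\<gamma> = \<epsilon>\<close> of the region.\<close>
  define \<epsilon> where "\<epsilon> = \<eta> / 2"
  have \<epsilon>: "\<epsilon> > 0" using \<eta> by (simp add: \<epsilon>_def)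
  obtain e d where "eventually (\<lambda>n. is_code n (R + \<epsilon>) (R0 + \<epsilon>) (e n) (d n) \<and>
         exp_dist D (code_joint P n (R0 + \<epsilon>) (e n) (d n)) \<le> \<Delta> + \<epsilon> \<and>
         measure_pmf.expectation (code_joint P n (R0 + \<epsilon>) (e n) (d n))
            (\<lambda>(xs, zs, ys). tv (emp xs) (emp ys)) \<le> Pm + \<epsilon>) sequentially"
    using assms \<epsilon> unfolding achievable_emp_def by blast
  from eventually_happens[OF eventually_conj[OF this eventually_gt_at_top[of 0]]]
  obtain n where code: "is_code n (R + \<epsilon>) (R0 + \<epsilon>) (e n) (d n)"
    and dist: "exp_dist D (code_joint P n (R0 + \<epsilon>) (e n) (d n)) \<le> \<Delta> + \<epsilon>"
    and tv: "measure_pmf.expectation (code_joint P n (R0 + \<epsilon>) (e n) (d n))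
            (\<lambda>(xs, zs, ys). tv (emp xs) (emp ys)) \<le> Pm + \<epsilon>"
    and n: "n > 0"
    by auto
  define L where "L = single_letter n (code_msg P n (R0 + \<epsilon>) (e n))"
  define J where "J = with_output L (letter_kernel (d n))"
  define M where "M = map_pmf (\<lambda>(x, u, z, y). (x, z, y)) J"
  have marg: "map_pmf (\<lambda>(x, u, z). (x, z)) L = P"
    unfolding L_def by (rule single_letter_marginal[OF n code_msg_source])
  have MP: "map_pmf (\<lambda>(x, z, y). (x, z)) M = P"
    using with_output_marginal[of "\<lambda>x u z. (x, z)" L] marg
    by (simp add: M_def J_def map_pmf_comp case_prod_unfold)
  then obtain W where W: "chan_joint P W = M"
    using exists_chan_joint by blast
  have "I_XY_Z M \<le> cmi L"
    using with_output_data_processing[of L "letter_kernel (d n)"] finite_single_letter[OF code n, of P]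
    by (simp add: I_XY_Z_def M_def J_def L_def map_pmf_comp case_prod_unfold)
  also have "\<dots> \<le> R + \<epsilon>"
    unfolding L_def by (rule code_cmi_source_le[OF code n])
  finally have "I_XY_Z M + \<epsilon> \<le> R + 2 * \<epsilon>" by simp
  moreover have "ED D M \<le> \<Delta> + \<epsilon>"
    using dist code_expectation[OF code n, of P D]
    by (simp add: ED_def exp_dist_def M_def J_def L_def case_prod_unfold)
  moreover have "tv (PX M) (PY M) \<le> Pm + \<epsilon>"
  proof -
    have "PX M = map_pmf fst P"
      unfolding MP[symmetric] by (simp add: PX_def map_pmf_comp case_prod_unfold)
    moreover have "PY M = map_pmf (\<lambda>(x, u, z, y). y) J"
      by (simp add: PY_def M_def map_pmf_comp case_prod_unfold)
    ultimately show ?thesis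
      using code_tv_le[OF code n, of P] tv by (simp add: J_def L_def)
  qed
  moreover have "R0 + \<epsilon> \<ge> 0"
    using idx_nonempty_imp_nonneg idx_nonempty(2)[OF code n] n by blast
  ultimately have "(R + 2 * \<epsilon>, R0 + \<epsilon>, \<Delta> + \<epsilon>, Pm + \<epsilon>) \<in> region_e_gamma P D \<epsilon>"
    unfolding region_e_gamma_def using W by auto
  then have "(R + 2 * \<epsilon>, R0 + \<epsilon>, \<Delta> + \<epsilon>, Pm + \<epsilon>) \<in> region_e P D"
    using \<epsilon> by (auto simp: region_e_def)
  then show "\<exists>a' b' c' d'. (a', b', c', d') \<in> region_e P D
     \<and> \<bar>a' - R\<bar> \<le> \<eta> \<and> \<bar>b' - R0\<bar> \<le> \<eta> \<and> \<bar>c' - \<Delta>\<bar> \<le> \<eta> \<and> \<bar>d' - Pm\<bar> \<le> \<eta>"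
    using \<eta> by (intro exI conjI) (assumption, auto simp: \<epsilon>_def)
qed

lemma achievable_strong_iid_converse:
  fixes P :: "('x::finite \<times> 'z::finite) pmf"
  assumes D: "\<And>a b. 0 \<le> D a b" "\<And>a b. D a b \<le> dmax"
    and ach: "achievable_strong_iid P D R R0 \<Delta> Pm"
  shows "(R, R0, \<Delta>, Pm) \<in> closure (region_s P D)"
proof (rule closure_quadrupleI)
  fix \<eta> :: real assume \<eta>: "\<eta> > 0"
  have dmax: "dmax \<ge> 0" using D order_trans by blast
  \<comment> \<open>For \<open>Pm < 1\<close> the second bound keeps \<open>Pm + \<epsilon>\<close>
    below 1, as separation requires. The choice \<open>\<eta> / 4\<close> leaves room for
    \<open>2 * \<epsilon>\<close> in both rates and for a correction cost of
    \<open>\<eta> / 2\<close> in the distortion.\<close>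
  define \<epsilon> where "\<epsilon> = (if Pm < 1 then min (\<eta> / 4) ((1 - Pm) / 2) else \<eta> / 4)"
  have \<epsilon>: "\<epsilon> > 0" "\<epsilon> \<le> \<eta> / 4" using \<eta> by (auto simp: \<epsilon>_def)
  have Pm\<epsilon>: "Pm + \<epsilon> < 1" if "Pm < 1"
  proof -
    have "\<epsilon> \<le> (1 - Pm) / 2" using that min.cobounded2[of "\<eta> / 4" "(1 - Pm) / 2"] unfolding \<epsilon>_def by (simp only: if_True)
    then show ?thesis using that by simp
  qed
  \<comment> \<open>Using \<open>dmax + 1\<close> keeps \<open>c\<close> positive when
    \<open>dmax = 0\<close>.\<close>
  define c where "c = (dmax + 1) * real CARD('x)"
  have c: "c > 0" unfolding c_def using dmax by (intro mult_pos_pos) auto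
  define \<delta> where "\<delta> = \<eta> / (2 * c)"
  have \<delta>: "\<delta> > 0" unfolding \<delta>_def using \<eta> c by simp
  have d\<delta>: "dmax * (real CARD('x) * \<delta>) \<le> \<eta> / 2"
  proof -
    have "dmax * (real CARD('x) * \<delta>) \<le> (dmax + 1) * (real CARD('x) * \<delta>)"
      using \<delta> by (intro mult_right_mono) auto
    also have "\<dots> = c * \<delta>" by (simp add: c_def)
    also have "\<dots> = \<eta> / 2" using c by (simp add: \<delta>_def)
    finally show ?thesis .
  qed
  have d\<delta>0: "dmax * (real CARD('x) * \<delta>) \<ge> 0" using dmax \<delta> by simp
  let ?PX = "map_pmf fst P"
  \<comment> \<open>The threshold on \<open>n\<close> has to serve all \<open>Q\<close> at once,
    because the output law is known only after \<open>n\<close> has been chosen.\<close>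
  have sep: "eventually (\<lambda>n. Pm < 1 \<longrightarrow> (\<forall>Q. tv (replicate_pmf n ?PX) (replicate_pmf n Q) \<le> Pm + \<epsilon>
            \<longrightarrow> (\<forall>a. \<bar>pmf ?PX a - pmf Q a\<bar> < \<delta>))) sequentially"
    using tv_replicate_separation[of "Pm + \<epsilon>" \<delta> ?PX] Pm\<epsilon> \<delta> by (cases "Pm < 1") auto
  obtain e d where "eventually (\<lambda>n. is_code n (R + \<epsilon>) (R0 + \<epsilon>) (e n) (d n) \<and>
         exp_dist D (code_joint P n (R0 + \<epsilon>) (e n) (d n)) \<le> \<Delta> + \<epsilon> \<and>
         tv (map_pmf (\<lambda>(xs, zs, ys). xs) (code_joint P n (R0 + \<epsilon>) (e n) (d n)))
            (map_pmf (\<lambda>(xs, zs, ys). ys) (code_joint P n (R0 + \<epsilon>) (e n) (d n))) \<le> Pm + \<epsilon> \<and>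
         (\<exists>Q :: ('x \<times> 'z) pmf.
            map_pmf (\<lambda>(xs, zs, ys). zip ys zs) (code_joint P n (R0 + \<epsilon>) (e n) (d n))
            = replicate_pmf n Q)) sequentially"
    using ach \<epsilon> unfolding achievable_strong_iid_def by blast
  from eventually_happens[OF eventually_conj[OF this eventually_conj[OF sep eventually_gt_at_top[of 0]]]]
  obtain n Q where code: "is_code n (R + \<epsilon>) (R0 + \<epsilon>) (e n) (d n)"
    and dist: "exp_dist D (code_joint P n (R0 + \<epsilon>) (e n) (d n)) \<le> \<Delta> + \<epsilon>"
    and tv: "tv (map_pmf (\<lambda>(xs, zs, ys). xs) (code_joint P n (R0 + \<epsilon>) (e n) (d n)))
            (map_pmf (\<lambda>(xs, zs, ys). ys) (code_joint P n (R0 + \<epsilon>) (e n) (d n))) \<le> Pm + \<epsilon>"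
    and iid: "map_pmf (\<lambda>(xs, zs, ys). zip ys zs) (code_joint P n (R0 + \<epsilon>) (e n) (d n)) = replicate_pmf n Q"
    and n: "n > 0"
    and sep: "Pm < 1 \<Longrightarrow> tv (replicate_pmf n ?PX) (replicate_pmf n (map_pmf fst Q)) \<le> Pm + \<epsilon>
            \<Longrightarrow> (\<forall>a. \<bar>pmf ?PX a - pmf (map_pmf fst Q) a\<bar> < \<delta>)"
    by auto
  define L where "L = single_letter n (code_msg P n (R0 + \<epsilon>) (e n))"
  define K where "K = letter_kernel (d n)"
  have fin: "finite (set_pmf L)"
    unfolding L_def by (rule finite_single_letter[OF code n])
  have marg: "map_pmf (\<lambda>(x, u, z). (x, z)) L = P"
    unfolding L_def by (rule single_letter_marginal[OF n code_msg_source])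
  have R: "cmi L \<le> R + \<epsilon>"
    unfolding L_def by (rule code_cmi_source_le[OF code n])
  have RR0: "cmi (map_pmf (\<lambda>(x, u, z, y). (y, u, z)) (with_output L K)) \<le> (R + \<epsilon>) + (R0 + \<epsilon>)"
    unfolding L_def K_def by (rule code_cmi_output_le[OF code n iid])
  have \<Delta>: "measure_pmf.expectation (with_output L K) (\<lambda>(x, u, z, y). D x y) \<le> \<Delta> + \<epsilon>"
    using dist unfolding L_def K_def code_expectation[OF code n] exp_dist_def .
  \<comment> \<open>The second \<open>\<epsilon>\<close> makes the rate strictly positive, as
    \<open>region_s_minus_gamma\<close> demands.\<close>
  have R0: "R0 + 2 * \<epsilon> > 0"
    using idx_nonempty_imp_nonneg[OF idx_nonempty(2)[OF code n] n] \<epsilon> by simp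
  have PY: "map_pmf (\<lambda>(x, u, z, y). y) (with_output L K) = map_pmf fst Q"
    unfolding code_output_marginal[OF code n iid, symmetric] L_def K_def
    by (simp add: map_pmf_comp case_prod_unfold)
  \<comment> \<open>\<open>V\<close> corrects the output letter: it is the coupling kernel if
    \<open>Pm < 1\<close> and the identity kernel otherwise.\<close>
  have "\<exists>V. measure_pmf.expectation (with_output L (\<lambda>u. bind_pmf (K u) V)) (\<lambda>(x, u, z, y). D x y)
        \<le> \<Delta> + \<epsilon> + dmax * (real CARD('x) * \<delta>)
      \<and> tv_lim ?PX (map_pmf (\<lambda>(x, u, z, y). y) (with_output L (\<lambda>u. bind_pmf (K u) V))) \<le> ereal (Pm + \<epsilon>)"
  proof (cases "Pm < 1")
    case True
    have close: "\<bar>pmf ?PX a - pmf (map_pmf fst Q) a\<bar> < \<delta>" for a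
      using sep[OF True] tv unfolding code_source_product[OF code n] code_output_product[OF code n iid] by blast
    obtain V where V: "bind_pmf (map_pmf fst Q) V = ?PX"
      and stay: "\<And>y. pmf (map_pmf fst Q) y * (1 - pmf (V y) y) \<le> \<bar>pmf ?PX y - pmf (map_pmf fst Q) y\<bar>"
      using exists_coupling_kernel[of "map_pmf fst Q" ?PX] by blast
    have "map_pmf (\<lambda>(x, u, z, y). y) (with_output L (\<lambda>u. bind_pmf (K u) V))
        = bind_pmf (map_pmf (\<lambda>(x, u, z, y). y) (with_output L K)) V"
      by (simp add: with_output_def map_bind_pmf bind_map_pmf map_pmf_comp bind_assoc_pmf case_prod_unfold)
    then have "map_pmf (\<lambda>(x, u, z, y). y) (with_output L (\<lambda>u. bind_pmf (K u) V)) = ?PX"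
      unfolding PY V .
    \<comment> \<open>With equal laws \<open>tv_lim\<close> is 0, so the perception bound has to be
      nonnegative; it dominates a total variation distance.\<close>
    moreover have "0 \<le> Pm + \<epsilon>"
      using tv tv_nonneg order_trans by blast
    moreover have "pmf (map_pmf (\<lambda>(x, u, z, y). y) (with_output L K)) y * (1 - pmf (V y) y) \<le> \<delta>" for y
      unfolding PY using stay[of y] close[of y] by linarith
    from with_output_post_processing_cost[where D = D, OF fin D this] \<Delta>
    have "measure_pmf.expectation (with_output L (\<lambda>u. bind_pmf (K u) V)) (\<lambda>(x, u, z, y). D x y)
        \<le> \<Delta> + \<epsilon> + dmax * (real CARD('x) * \<delta>)"
      by linarith
    ultimately show ?thesis
      by (intro exI[of _ V]) (simp add: tv_lim_self)
  next
    case False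
    then have "tv_lim ?PX Y \<le> ereal (Pm + \<epsilon>)" for Y
      using tv_lim_le_1[of ?PX Y] \<epsilon> by (elim order_trans) (simp add: one_ereal_def)
    then show ?thesis
      using \<Delta> d\<delta>0 by (intro exI[of _ return_pmf]) (simp add: bind_return_pmf')
  qed
  then obtain V where
    V: "measure_pmf.expectation (with_output L (\<lambda>u. bind_pmf (K u) V)) (\<lambda>(x, u, z, y). D x y)
        \<le> \<Delta> + \<epsilon> + dmax * (real CARD('x) * \<delta>)"
      "tv_lim ?PX (map_pmf (\<lambda>(x, u, z, y). y) (with_output L (\<lambda>u. bind_pmf (K u) V))) \<le> ereal (Pm + \<epsilon>)"
    by blast
  have RR0': "cmi (map_pmf (\<lambda>(x, u, z, y). (y, u, z)) (with_output L (\<lambda>u. bind_pmf (K u) V))) + \<epsilon>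
      \<le> (R + 2 * \<epsilon>) + (R0 + 2 * \<epsilon>)"
    using with_output_post_processing[OF fin, of K V] RR0 \<epsilon> by linarith
  have "(R + 2 * \<epsilon>, R0 + 2 * \<epsilon>, \<Delta> + \<epsilon> + dmax * (real CARD('x) * \<delta>), Pm + \<epsilon>) \<in> region_s P D"
    by (rule region_s_intro[OF fin \<epsilon>(1) R0 marg _ RR0' V]) (use R in simp)
  then show "\<exists>a' b' c' d'. (a', b', c', d') \<in> region_s P D
     \<and> \<bar>a' - R\<bar> \<le> \<eta> \<and> \<bar>b' - R0\<bar> \<le> \<eta> \<and> \<bar>c' - \<Delta>\<bar> \<le> \<eta> \<and> \<bar>d' - Pm\<bar> \<le> \<eta>"
    using \<eta> \<epsilon> d\<delta> d\<delta>0 by (intro exI conjI) (assumption, auto)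
qed

theorem theorem2:
  fixes P :: "('x::finite \<times> 'z::finite) pmf"
    and D :: "'x \<Rightarrow> 'x \<Rightarrow> real"
    and dmax :: real
    and R R0 \<Delta> Pm :: real
  assumes D_range: "\<And>a b. 0 \<le> D a b \<and> D a b \<le> dmax"
  shows "(achievable_emp P D R R0 \<Delta> Pm \<longrightarrow> (R, R0, \<Delta>, Pm) \<in> closure (region_e P D))
       \<and> (achievable_strong_iid P D R R0 \<Delta> Pm \<longrightarrow> (R, R0, \<Delta>, Pm) \<in> closure (region_s P D))"
  using achievable_emp_converse[of P D R R0 \<Delta> Pm]
    achievable_strong_iid_converse[of D dmax P R R0 \<Delta> Pm] D_range by blast

end
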